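(* Let $p$ and $p'$ be $n$-component nanophrases over $\alpha_v=\{a_+,a_-,b_+,b_-\}$ which are $M$-homotopic with respect to $(\alpha_v,\tau_v,S_v)$, $\nu_v$ and $\sigma_v$. Let $u\ge 1$ and let $c_1,c_2,\ldots,c_u,i$ be pairwise distinct integers between $1$ and $n$. Then $\bar\mu(p;c_1,c_2,\ldots,c_u,i)=\bar\mu(p';c_1,c_2,\ldots,c_u,i)$. In other words, $\bar\mu(\,\cdot\,;c_1,\ldots,c_u,i)$ is an invariant of nanophrases under $M$-homotopy.
   Context: **Nanophrases.** Let $\alpha_v=\{a_+,a_-,b_+,b_-\}$. An $\alpha_v$-alphabet is a finite set $\mathcal A$ (of letters) with a map $\mathcal A\to\alpha_v$, $A\mapsto|A|$ (the projection). An $n$-component nanophrase over $\alpha_v$ is a pair $(\mathcal A,p)$ where $\mathcal A$ is an $\alpha_v$-alphabet and $p=w_1|w_2|\cdots|w_n$ is a sequence of $n$ (possibly empty) finite words in $\mathcal A$ such that each letter of $\mathcal A$ occurs exactly twice in the concatenation $w_1w_2\cdots w_n$. We write $p$ for $(\mathcal A,p)$. **$M$-homotopy.** Let $\tau_v,\nu_v,\sigma_v$ be the involutions of $\alpha_v$ with $\tau_v:a_+\leftrightarrow b_-,\ a_-\leftrightarrow b_+$; $\nu_v:a_+\leftrightarrow b_+,\ a_-\leftrightarrow b_-$; $\sigma_v:a_+\leftrightarrow a_-,\ b_+\leftrightarrow b_-$. Let $S_v\subset\alpha_v^3$ consist of the triples $(a_+,a_+,a_+)$, $(a_+,a_+,a_-)$,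 $(a_+,a_-,a_-)$, $(a_-,a_-,a_-)$, $(a_-,a_-,a_+)$, $(a_-,a_+,a_+)$ and the six triples obtained from these by replacing $a$ by $b$. $M$-homotopy with respect to $(\alpha_v,\tau_v,S_v)$, $\nu_v$, $\sigma_v$ is the equivalence relation on nanophrases generated by the following; in H1–H3, $x,y,z,t$ are arbitrary sequences of letters possibly containing separators `$|$', such that both sides are nanophrases, and projections of remaining letters are unchanged. - Isomorphism: a bijection $f:\mathcal A_1\to\mathcal A_2$ with $|f(A)|=|A|$ sending, letterwise, the $i$th component of $p_1$ to the $i$th component of $p_2$ for all $i$. - H1: $(\mathcal A,xAAy)\leftrightarrow(\mathcal A-\{A\},xy)$, for any $|A|$. - H2: $(\mathcal A,xAByBAz)\leftrightarrow(\mathcal A-\{A,B\},xyz)$, if $\tau_v(|A|)=|B|$. - H3: $(\mathcal A,xAByACzBCt)\leftrightarrow(\mathcal A,xBAyCAzCBt)$, if $(|A|,|B|,|C|)\in S_v$. - Shift move on the $i$th component: if this component is empty or a single letter, nothing changes. Otherwise it has the form $Ax$ and is replaced by $xA$, all other components unchanged; $|A|$ is replaced by $\nu_v(|A|)$ if $x$ contains $A$, and is unchanged otherwise; the projections of other letters are unchanged. - Self crossing move: if a letter $A$ occurs twice in one component, replace $|A|$ by $\sigma_v(|A|)$, keeping the phrase and all other projections. **Signed words.** Let $p=w_1|\cdots|w_n$ with $w_i=A_{i1}A_{i2}\cdots A_{im_i}$. For each position $(i,j)$, let $A$ be the letter $A_{ij}$ and let $(k,l)\ne(i,j)$ be the position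 of the other occurrence of $A$. Put $\varepsilon_{ij}=1$ if ($i<k$ and $|A|=b_+$) or ($i>k$ and $|A|=a_+$); $\varepsilon_{ij}=-1$ if ($i<k$ and $|A|=a_-$) or ($i>k$ and $|A|=b_-$); $\varepsilon_{ij}=0$ otherwise. Put $w_i^{\varepsilon}=A_{i1}^{\varepsilon_{i1}}\cdots A_{im_i}^{\varepsilon_{im_i}}$, a word on $\mathcal A\cup\mathcal A^{-1}$, with $A^0=\emptyset$ the empty word. Formal inverse: $(A_1A_2\cdots A_m)^{-1}=A_m^{-1}\cdots A_1^{-1}$, with $(A^{-1})^{-1}=A$; no cancellation is performed in words. A letter whose two occurrences lie in different components has exactly one occurrence with nonzero sign; only such letters appear in the words $w_i^\varepsilon$. **Maps $\rho^q$, $\eta$, $\varphi$.** For a letter $A$ whose two occurrences lie in different components, let $(i,j)$ be its occurrence with $\varepsilon_{ij}\neq0$, $(k,l)$ the other one, and $x_A=A_{k1}^{\varepsilon_{k1}}\cdots A_{k,l-1}^{\varepsilon_{k,l-1}}$. Define maps $\rho^q$ ($q\ge2$) on words in such letters and their inverses, multiplicative with respect to concatenation, with $\rho^q(\emptyset)=\emptyset$, by $\rho^2(A^{\pm1})=A^{\pm1}$ and $\rho^q(A^{\pm1})=\rho^{q-1}(x_A^{-1})\,A^{\pm1}\,\rho^{q-1}(x_A)$ for $q\ge3$. Let $\eta$ be the multiplicative map to words on $\{a_1^{\pm1},\ldots,a_n^{\pm1}\}$ with $\eta(A^{\pm1})=a_k^{\pm1}$, where $k$ is the index of the component containing the second occurrence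 of $A$ in $p$ if $|A|\in\{b_+,a_-\}$, and the first occurrence if $|A|\in\{a_+,b_-\}$. Let $\varphi$ be the multiplicative map from words on $\{a_1^{\pm1},\ldots,a_n^{\pm1}\}$ to the ring $\mathbb Z[[\kappa_1,\ldots,\kappa_n]]$ of formal power series in non-commuting variables, with $\varphi(\emptyset)=1$, $\varphi(a_h)=1+\kappa_h$, $\varphi(a_h^{-1})=1-\kappa_h+\kappa_h^2-\kappa_h^3+\cdots$. **$\mu$, $\Delta$, $\bar\mu$.** For each monomial, its coefficient in $\varphi\circ\eta(\rho^q(w_i^\varepsilon))$ is eventually constant in $q$. For $u\geq 1$ and indices $c_1,\ldots,c_u,i\in\{1,\ldots,n\}$ (not necessarily distinct), $\mu(p;c_1,\ldots,c_u,i)\in\mathbb Z$ is the eventual coefficient of $\kappa_{c_1}\kappa_{c_2}\cdots\kappa_{c_u}$, so $\lim_{q\to\infty}\varphi\circ\eta(\rho^q(w_i^\varepsilon))=1+\sum\mu(p;c_1,\ldots,c_u,i)\kappa_{c_1}\cdots\kappa_{c_u}$. Put $\Delta(p;c_1,i)=0$, and for $u\ge2$ let $\Delta(p;c_1,\ldots,c_u,i)\geq 0$ be the greatest common divisor of the integers $\mu(p;d_1,\ldots,d_t)$, where $d_1,\ldots,d_t$ ($2\le t\le u$) ranges over all sequences obtained by eliminating at least one of $c_1,\ldots,c_u,i$ and permuting the remaining indices cyclically (the gcd of zeros is $0$). Then $\bar\mu(p;c_1,\ldots,c_u,i)$ is the residue class of $\mu(p;c_1,\ldots,c_u,i)$ modulo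 $\Delta(p;c_1,\ldots,c_u,i)$ (a residue class modulo $0$ is the integer itself). Equality of $\bar\mu$ for two nanophrases means that the moduli $\Delta$ agree and the residue classes agree. *)

theory Defs
  imports "HOL-Library.Sublist" "HOL-Number_Theory.Cong"
begin

section \<open>Nanophrases\<close>

datatype alpha_v = a_plus | a_minus | b_plus | b_minus

text \<open>
  A word is a list of letters and a phrase a list of words.  Components are numbered from 0, so
  the indices of an $n$-component nanophrase are the elements of \<open>{..<n}\<close>.  The values of
  \<open>proj\<close> outside \<open>alphabet\<close> carry no information; they can be changed by an isomorphism move.
\<close>

record 'a nanophrase =
  alphabet :: "'a set"
  proj :: "'a \<Rightarrow> alpha_v"
  phrase :: "'a list list"

definition nanophrase :: "nat \<Rightarrow> 'a nanophrase \<Rightarrow> bool" where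
  "nanophrase n p \<longleftrightarrow>
     finite (alphabet p) \<and> length (phrase p) = n \<and>
     set (concat (phrase p)) \<subseteq> alphabet p \<and>
     (\<forall>A \<in> alphabet p. count_list (concat (phrase p)) A = 2)"


section \<open>M-homotopy\<close>

fun tau_v :: "alpha_v \<Rightarrow> alpha_v" where
  "tau_v a_plus = b_minus"
| "tau_v b_minus = a_plus"
| "tau_v a_minus = b_plus"
| "tau_v b_plus = a_minus"

fun nu_v :: "alpha_v \<Rightarrow> alpha_v" where
  "nu_v a_plus = b_plus"
| "nu_v b_plus = a_plus"
| "nu_v a_minus = b_minus"
| "nu_v b_minus = a_minus"

fun sigma_v :: "alpha_v \<Rightarrow> alpha_v" where
  "sigma_v a_plus = a_minus"
| "sigma_v a_minus = a_plus"
| "sigma_v b_plus = b_minus"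
| "sigma_v b_minus = b_plus"

definition S_v :: "(alpha_v \<times> alpha_v \<times> alpha_v) set" where
  "S_v =
     {(a_plus, a_plus, a_plus), (a_plus, a_plus, a_minus), (a_plus, a_minus, a_minus),
      (a_minus, a_minus, a_minus), (a_minus, a_minus, a_plus), (a_minus, a_plus, a_plus),
      (b_plus, b_plus, b_plus), (b_plus, b_plus, b_minus), (b_plus, b_minus, b_minus),
      (b_minus, b_minus, b_minus), (b_minus, b_minus, b_plus), (b_minus, b_plus, b_plus)}"

text \<open>
  The phrase $w_1|\cdots|w_n$ as one sequence in which \<open>None\<close> is the separator.  On nonempty lists
  of words this is injective; the lists \<open>[]\<close> and \<open>[[]]\<close> have the same image, but they have
  different numbers of components.
\<close>

fun flat :: "'a list list \<Rightarrow> 'a option list" where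
  "flat [] = []"
| "flat [w] = map Some w"
| "flat (w # v # ws) = map Some w @ None # flat (v # ws)"

definition isomorphism_move :: "'a nanophrase \<Rightarrow> 'a nanophrase \<Rightarrow> bool" where
  "isomorphism_move p p' \<longleftrightarrow>
     (\<exists>f. bij_betw f (alphabet p) (alphabet p') \<and>
          (\<forall>A \<in> alphabet p. proj p' (f A) = proj p A) \<and>
          phrase p' = map (map f) (phrase p))"

definition H1_move :: "'a nanophrase \<Rightarrow> 'a nanophrase \<Rightarrow> bool" where
  "H1_move p p' \<longleftrightarrow>
     (\<exists>A x y.
        flat (phrase p) = x @ [Some A, Some A] @ y \<and>
        flat (phrase p') = x @ y \<and>
        alphabet p' = alphabet p - {A} \<and>
        (\<forall>L \<in> alphabet p'. proj p' L = proj p L))"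

definition H2_move :: "'a nanophrase \<Rightarrow> 'a nanophrase \<Rightarrow> bool" where
  "H2_move p p' \<longleftrightarrow>
     (\<exists>A B x y z.
        flat (phrase p) = x @ [Some A, Some B] @ y @ [Some B, Some A] @ z \<and>
        flat (phrase p') = x @ y @ z \<and>
        tau_v (proj p A) = proj p B \<and>
        alphabet p' = alphabet p - {A, B} \<and>
        (\<forall>L \<in> alphabet p'. proj p' L = proj p L))"

definition H3_move :: "'a nanophrase \<Rightarrow> 'a nanophrase \<Rightarrow> bool" where
  "H3_move p p' \<longleftrightarrow>
     (\<exists>A B C x y z t.
        flat (phrase p) =
          x @ [Some A, Some B] @ y @ [Some A, Some C] @ z @ [Some B, Some C] @ t \<and>
        flat (phrase p') =
          x @ [Some B, Some A] @ y @ [Some C, Some A] @ z @ [Some C, Some B] @ t \<and>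
        (proj p A, proj p B, proj p C) \<in> S_v \<and>
        alphabet p' = alphabet p \<and>
        (\<forall>L \<in> alphabet p'. proj p' L = proj p L))"

text \<open>
  A shift of an empty component changes nothing and is omitted; for a single letter the formula
  below changes nothing either.
\<close>

definition shift_move :: "'a nanophrase \<Rightarrow> 'a nanophrase \<Rightarrow> bool" where
  "shift_move p p' \<longleftrightarrow>
     (\<exists>i A x.
        i < length (phrase p) \<and> phrase p ! i = A # x \<and>
        phrase p' = (phrase p)[i := x @ [A]] \<and>
        alphabet p' = alphabet p \<and>
        (\<forall>L \<in> alphabet p. proj p' L = (if L = A \<and> A \<in> set x then nu_v (proj p L) else proj p L)))"

definition self_crossing_move :: "'a nanophrase \<Rightarrow> 'a nanophrase \<Rightarrow> bool" where
  "self_crossing_move p p' \<longleftrightarrow>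
     (\<exists>i A.
        i < length (phrase p) \<and> count_list (phrase p ! i) A = 2 \<and>
        phrase p' = phrase p \<and>
        alphabet p' = alphabet p \<and>
        (\<forall>L \<in> alphabet p. proj p' L = (if L = A then sigma_v (proj p L) else proj p L)))"

definition M_move :: "nat \<Rightarrow> 'a nanophrase \<Rightarrow> 'a nanophrase \<Rightarrow> bool" where
  "M_move n p p' \<longleftrightarrow>
     nanophrase n p \<and> nanophrase n p' \<and>
     (isomorphism_move p p' \<or> H1_move p p' \<or> H2_move p p' \<or> H3_move p p' \<or>
      shift_move p p' \<or> self_crossing_move p p')"

text \<open>
  All nanophrases of a chain of moves have letters in the type \<open>'a\<close>.  As alphabets are finite and
  can be renamed by isomorphisms, this is no restriction when \<open>'a\<close> is infinite.
\<close>

definition M_homotopic :: "nat \<Rightarrow> 'a nanophrase \<Rightarrow> 'a nanophrase \<Rightarrow> bool" where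
  "M_homotopic n = equivclp (M_move n)"


section \<open>Signed words\<close>

text \<open>
  A word on $X \cup X^{-1}$ is a list of pairs \<open>(x, s)\<close>, standing for $x$ if \<open>s\<close> and for $x^{-1}$
  otherwise.
\<close>

type_synonym 'x sword = "('x \<times> bool) list"

definition inv_word :: "'x sword \<Rightarrow> 'x sword" where
  "inv_word w = rev (map (\<lambda>(x, s). (x, \<not> s)) w)"

definition positions :: "'a nanophrase \<Rightarrow> (nat \<times> nat) set" where
  "positions p = {(i, j). i < length (phrase p) \<and> j < length (phrase p ! i)}"

fun letter_at :: "'a nanophrase \<Rightarrow> nat \<times> nat \<Rightarrow> 'a" where
  "letter_at p (i, j) = phrase p ! i ! j"

definition other_occ :: "'a nanophrase \<Rightarrow> nat \<times> nat \<Rightarrow> nat \<times> nat" where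
  "other_occ p r = (THE s. s \<in> positions p \<and> s \<noteq> r \<and> letter_at p s = letter_at p r)"

definition eps :: "'a nanophrase \<Rightarrow> nat \<times> nat \<Rightarrow> int" where
  "eps p r =
     (let i = fst r; k = fst (other_occ p r); c = proj p (letter_at p r) in
        if (i < k \<and> c = b_plus) \<or> (i > k \<and> c = a_plus) then 1
        else if (i < k \<and> c = a_minus) \<or> (i > k \<and> c = b_minus) then -1
        else 0)"

definition signed_letter :: "'a nanophrase \<Rightarrow> nat \<times> nat \<Rightarrow> 'a sword" where
  "signed_letter p r =
     (if eps p r = 1 then [(letter_at p r, True)]
      else if eps p r = -1 then [(letter_at p r, False)]
      else [])"

text \<open>\<open>signed_prefix p i m\<close> is the signed word of the first \<open>m\<close> letters of component \<open>i\<close>.\<close>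

definition signed_prefix :: "'a nanophrase \<Rightarrow> nat \<Rightarrow> nat \<Rightarrow> 'a sword" where
  "signed_prefix p i m = concat (map (\<lambda>j. signed_letter p (i, j)) [0..<m])"

definition signed_word :: "'a nanophrase \<Rightarrow> nat \<Rightarrow> 'a sword" where
  "signed_word p i = signed_prefix p i (length (phrase p ! i))"


section \<open>The maps rho, eta and phi\<close>

definition signed_occ :: "'a nanophrase \<Rightarrow> 'a \<Rightarrow> nat \<times> nat" where
  "signed_occ p A = (THE r. r \<in> positions p \<and> letter_at p r = A \<and> eps p r \<noteq> 0)"

definition x_word :: "'a nanophrase \<Rightarrow> 'a \<Rightarrow> 'a sword" where
  "x_word p A = (case other_occ p (signed_occ p A) of (k, l) \<Rightarrow> signed_prefix p k l)"

text \<open>Only \<open>rho p q\<close> with \<open>q \<ge> 2\<close> is meaningful.\<close>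

fun rho :: "'a nanophrase \<Rightarrow> nat \<Rightarrow> 'a sword \<Rightarrow> 'a sword" where
  "rho p q w =
     concat (map (\<lambda>(A, s).
       if q \<le> 2 then [(A, s)]
       else rho p (q - 1) (inv_word (x_word p A)) @ [(A, s)] @ rho p (q - 1) (x_word p A)) w)"

declare rho.simps [simp del]

text \<open>
  The occurrences of a letter are ordered as in $w_1 w_2 \cdots w_n$, so the first one lies in the
  component of least index containing the letter and the second one in that of greatest index.
\<close>

definition first_comp :: "'a nanophrase \<Rightarrow> 'a \<Rightarrow> nat" where
  "first_comp p A = Min {i. i < length (phrase p) \<and> A \<in> set (phrase p ! i)}"

definition second_comp :: "'a nanophrase \<Rightarrow> 'a \<Rightarrow> nat" where
  "second_comp p A = Max {i. i < length (phrase p) \<and> A \<in> set (phrase p ! i)}"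

definition eta :: "'a nanophrase \<Rightarrow> 'a sword \<Rightarrow> nat sword" where
  "eta p w =
     map (\<lambda>(A, s).
       (if proj p A \<in> {b_plus, a_minus} then second_comp p A else first_comp p A, s)) w"

text \<open>
  A formal power series over the integers in the non-commuting variables $\kappa_h$ is the
  function giving the coefficient of each monomial, the list \<open>[c\<^sub>1, \<dots>, c\<^sub>u]\<close> being the monomial
  $\kappa_{c_1} \cdots \kappa_{c_u}$.
\<close>

type_synonym nc_series = "nat list \<Rightarrow> int"

definition nc_one :: nc_series where
  "nc_one m = (if m = [] then 1 else 0)"

definition nc_times :: "nc_series \<Rightarrow> nc_series \<Rightarrow> nc_series" where
  "nc_times f g m = (\<Sum>k\<le>length m. f (take k m) * g (drop k m))"

text \<open>The series $1 + \kappa_h$ and $1 - \kappa_h + \kappa_h^2 - \cdots$:\<close>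

fun phi_letter :: "nat \<times> bool \<Rightarrow> nc_series" where
  "phi_letter (h, True) = (\<lambda>m. if m = [] \<or> m = [h] then 1 else 0)"
| "phi_letter (h, False) = (\<lambda>m. if m = replicate (length m) h then (- 1) ^ length m else 0)"

fun phi :: "nat sword \<Rightarrow> nc_series" where
  "phi [] = nc_one"
| "phi (l # w) = nc_times (phi_letter l) (phi w)"


section \<open>The numbers mu and Delta, and the invariant\<close>

text \<open>\<open>mu p [c\<^sub>1, \<dots>, c\<^sub>u] i\<close> is the eventual value, as \<open>q\<close> grows, of the coefficient.\<close>

definition mu :: "'a nanophrase \<Rightarrow> nat list \<Rightarrow> nat \<Rightarrow> int" where
  "mu p c i =
     (THE m. \<forall>\<^sub>F q in sequentially. phi (eta p (rho p q (signed_word p i))) c = m)"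

text \<open>
  The sequences $d_1, \ldots, d_t$ with $t \ge 2$ obtained from \<open>e\<close> by eliminating at least one
  entry and permuting the remaining ones cyclically.
\<close>

definition reduced_cyclic :: "nat list \<Rightarrow> nat list set" where
  "reduced_cyclic e =
     {d. 2 \<le> length d \<and>
         (\<exists>f r. subseq f e \<and> length f < length e \<and> d = rotate r f)}"

text \<open>
  For \<open>c\<close> of length 1 there are no such sequences, and \<open>Gcd {} = 0\<close> is the prescribed value.
\<close>

definition Delta :: "'a nanophrase \<Rightarrow> nat list \<Rightarrow> nat \<Rightarrow> int" where
  "Delta p c i = Gcd ((\<lambda>d. mu p (butlast d) (last d)) ` reduced_cyclic (c @ [i]))"

text \<open>The modulus together with the residue class, a singleton if the modulus is 0.\<close>

definition mu_bar :: "'a nanophrase \<Rightarrow> nat list \<Rightarrow> nat \<Rightarrow> int \<times> int set" where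
  "mu_bar p c i = (Delta p c i, {m. [m = mu p c i] (mod Delta p c i)})"

end

theory Submission
  imports Defs
begin

text \<open>
  As in Milnor's work, $\mu$ is read off from longitudes in a group generated by meridians.  Here the
  group consists of upper triangular matrices over $\mathbb{Z}/D$, with the meridian of the first arc of
  component $c_s$ sent to $1 + E_{s,s+1}$: since the indices are distinct, any two conjugates of
  one meridian commute, so self crossings can be ignored, and $\mu(c_1, \ldots, c_u, i)$ is the
  corner entry of the longitude of component $i$.  The meridians of all arcs are the unique solution
  of the Wirtinger-type equations, by a contraction argument in the filtration by
  superdiagonals, and such a solution is transported explicitly along every move.
  Only a shift needs $D = \Delta$: modulo $\Delta$ a longitude commutes with its own
  meridian, and a conjugation of the generator $1 + E_{s,s+1}$ does not affect the corner entry.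
\<close>

section \<open>Triangular matrices over residues\<close>

\<comment> \<open>The images of the generators are kept under every move except a shift, which
  conjugates one of them. For the other moves \<open>D\<close> = 0 may therefore be taken, and the
  integers \<mu> themselves agree. The obstacle is the third move with two of its strands in one
  component. The crossing of these two contributes no factor, so the products on the two sides of
  the move can differ. They differ only by terms annihilated by the local conjugate of that
  component's generator, so the equations for the meridians survive, but the longitude of that
  component may change. Since \<open>i\<close> is not among the indices in \<open>c\<close>, its
  generator is sent to 0, and for such a component nothing is lost. The moves H1 to H3 cut a phrase
  at places whose components may or may not coincide. The equations are therefore restated as a
  condition checked while reading the phrase with its separators, and each move becomes a local
  change of this reading. The modulus must be shown invariant too. It is built from \<mu> of shorter
  sequences, of which induction gives only residues; these suffice because \<Delta> of a sequence
  divides \<Delta> of each sequence entering it.\<close>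
text \<open>
  The product of the rings $\mathbb{Z}/D$ over all \<open>D\<close>, so that one type serves every modulus;
  \<open>idem D\<close> is the unit of the factor $\mathbb{Z}/D$.
\<close>

quotient_type residues = "int \<Rightarrow> int" / "\<lambda>f g. \<forall>D. [f D = g D] (mod D)"
  by (rule equivpI) (auto simp: reflp_def symp_def transp_def cong_sym_eq intro: cong_trans)

instantiation residues :: comm_ring_1
begin

lift_definition zero_residues :: residues is "\<lambda>_. 0" .
lift_definition one_residues :: residues is "\<lambda>_. 1" .
lift_definition plus_residues :: "residues \<Rightarrow> residues \<Rightarrow> residues" is "\<lambda>f g D. f D + g D"
  by (auto intro: cong_add)
lift_definition minus_residues :: "residues \<Rightarrow> residues \<Rightarrow> residues" is "\<lambda>f g D. f D - g D"
  by (auto intro: cong_diff)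
lift_definition uminus_residues :: "residues \<Rightarrow> residues" is "\<lambda>f D. - f D"
  by (auto simp: cong_minus_minus_iff)
lift_definition times_residues :: "residues \<Rightarrow> residues \<Rightarrow> residues" is "\<lambda>f g D. f D * g D"
  by (auto intro: cong_mult)

instance
proof
  show "(0::residues) \<noteq> 1"
    \<comment> \<open>The factor at 0 is the ring of integers, which separates 0 from 1; the factor
      at 1 would not.\<close>
    by transfer (auto intro!: exI[of _ 0])
qed (transfer; simp add: algebra_simps)+

end

lift_definition idem :: "int \<Rightarrow> residues" is "\<lambda>D x. if x = D then 1 else 0" .

lemma idem_idem [simp]: "idem D * idem D = idem D"
  by transfer auto

lift_definition residues_const :: "int \<Rightarrow> residues" is "\<lambda>k _. k" .

text \<open>\<open>of_int\<close> is not a lifted operation; this form makes it accessible to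
  transfer, and so turns ring equations into divisibility by \<open>D\<close>.\<close>

lemma of_int_residues: "of_int k = residues_const k"
proof -
  have nat: "of_nat m = residues_const (int m)" for m
  proof (induction m)
    case 0
    show ?case by simp (transfer, simp)
  next
    case (Suc m)
    have "residues_const (int (Suc m)) = 1 + residues_const (int m)"
      by transfer (rule allI, simp)
    with Suc show ?case by simp
  qed
  show ?thesis
  proof (cases k)
    case (nonneg m)
    then show ?thesis by (simp add: nat)
  next
    case (neg m)
    have "residues_const (- int (Suc m)) = - residues_const (int (Suc m))"
      by transfer (rule allI, simp)
    then show ?thesis by (simp only: neg of_int_minus of_int_of_nat_eq nat)
  qed
qed

lemma of_int_mult_idem_eq_0: "of_int k * idem D = 0 \<longleftrightarrow> D dvd k"
  unfolding of_int_residues by transfer (auto simp: cong_0_iff)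

lemma of_int_mult_idem_eq_iff: "of_int k * idem D = of_int l * idem D \<longleftrightarrow> [k = l] (mod D)"
  using of_int_mult_idem_eq_0[of "k - l" D] by (simp add: cong_iff_dvd_diff left_diff_distrib)

text \<open>Infinite matrices need no size parameter, so one type serves all lengths of
  \<open>c\<close>; triangularity keeps the sums in a product finite.\<close>

typedef (overloaded) 'b tri = "{f :: nat \<Rightarrow> nat \<Rightarrow> 'b::zero. \<forall>a b. b < a \<longrightarrow> f a b = 0}"
  morphisms ent Abs_tri
  by auto

setup_lifting type_definition_tri

lemma ent_below: "b < a \<Longrightarrow> ent x a b = 0"
  using ent[of x] by auto

lemma tri_eqI: "(\<And>a b. ent x a b = ent y a b) \<Longrightarrow> x = y"
  by (auto simp: ent_inject[symmetric])

instantiation tri :: (comm_ring_1) ring_1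
begin

lift_definition zero_tri :: "'a tri" is "\<lambda>_ _. 0" by simp
lift_definition one_tri :: "'a tri" is "\<lambda>a b. if a = b then 1 else 0" by simp
lift_definition plus_tri :: "'a tri \<Rightarrow> 'a tri \<Rightarrow> 'a tri" is "\<lambda>f g a b. f a b + g a b" by simp
lift_definition minus_tri :: "'a tri \<Rightarrow> 'a tri \<Rightarrow> 'a tri" is "\<lambda>f g a b. f a b - g a b" by simp
lift_definition uminus_tri :: "'a tri \<Rightarrow> 'a tri" is "\<lambda>f a b. - f a b" by simp
lift_definition times_tri :: "'a tri \<Rightarrow> 'a tri \<Rightarrow> 'a tri" is
  "\<lambda>f g a b. \<Sum>k=a..b. f a k * g k b" by simp

lemmas ent_simps [simp] =
  zero_tri.rep_eq one_tri.rep_eq plus_tri.rep_eq minus_tri.rep_eq uminus_tri.rep_eq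

lemma ent_times: "ent (x * y) a b = (\<Sum>k=a..b. ent x a k * ent y k b)"
  by (rule times_tri.rep_eq[THEN fun_cong, THEN fun_cong])

instance
proof
  fix x y z :: "'a tri"
  show "x * y * z = x * (y * z)"
  proof (rule tri_eqI)
    fix a b
    have "ent (x * y * z) a b = (\<Sum>k=a..b. \<Sum>l=a..b. ent x a l * ent y l k * ent z k b)"
      unfolding ent_times sum_distrib_right
      by (intro sum.cong refl sum.mono_neutral_left) (auto simp: ent_below)
    also have "\<dots> = (\<Sum>l=a..b. \<Sum>k=a..b. ent x a l * ent y l k * ent z k b)"
      by (rule sum.swap)
    also have "\<dots> = ent (x * (y * z)) a b"
      unfolding ent_times sum_distrib_left mult.assoc
      by (intro sum.cong refl sum.mono_neutral_right) (auto simp: ent_below)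
    finally show "ent (x * y * z) a b = ent (x * (y * z)) a b" .
  qed
  show "1 * x = x"
  proof (rule tri_eqI)
    fix a b
    have "ent (1 * x) a b = (\<Sum>k=a..b. if k = a then ent x k b else 0)"
      unfolding ent_times by (intro sum.cong) auto
    then show "ent (1 * x) a b = ent x a b" by (auto simp: ent_below)
  qed
  show "x * 1 = x"
  proof (rule tri_eqI)
    fix a b
    have "ent (x * 1) a b = (\<Sum>k=a..b. if k = b then ent x a k else 0)"
      unfolding ent_times by (intro sum.cong) auto
    then show "ent (x * 1) a b = ent x a b" by (auto simp: ent_below)
  qed
  show "(x + y) * z = x * z + y * z" "x * (y + z) = x * y + x * z"
    by (rule tri_eqI; simp add: ent_times algebra_simps sum.distrib)+
  have "ent (0 :: 'a tri) 0 0 \<noteq> ent 1 0 0" by simp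
  then show "(0 :: 'a tri) \<noteq> 1" by metis
qed (rule tri_eqI; simp add: algebra_simps)+

end

lemma ent_sum: "ent (sum f S) a b = (\<Sum>s\<in>S. ent (f s) a b)"
  by (induction S rule: infinite_finite_induct) auto

lemma ent_of_int: "ent (of_int k :: 'b::comm_ring_1 tri) a b = (if a = b then of_int k else 0)"
proof -
  have nat: "ent (of_nat m :: 'b tri) a b = (if a = b then of_nat m else 0)" for m
    by (induction m) auto
  show ?thesis by (cases k) (auto simp: nat)
qed

text \<open>The ideal of matrices vanishing on the first \<open>d\<close> diagonals, the main one
  included; \<open>fil 1\<close> is the strictly triangular part. No power of it is zero here, and
  \<open>fil_separated\<close> takes the place of nilpotence.\<close>

definition fil :: "nat \<Rightarrow> 'b::comm_ring_1 tri set" where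
  "fil d = {x. \<forall>a b. b < a + d \<longrightarrow> ent x a b = 0}"

lemma fil_0 [simp]: "x \<in> fil 0"
  by (simp add: fil_def ent_below)

lemma zero_in_fil [simp]: "0 \<in> fil d"
  by (simp add: fil_def)

lemma fil_add: "x \<in> fil d \<Longrightarrow> y \<in> fil d \<Longrightarrow> x + y \<in> fil d"
  and fil_diff: "x \<in> fil d \<Longrightarrow> y \<in> fil d \<Longrightarrow> x - y \<in> fil d"
  and fil_uminus: "x \<in> fil d \<Longrightarrow> - x \<in> fil d"
  by (simp_all add: fil_def)

lemma fil_sum: "(\<And>s. s \<in> S \<Longrightarrow> f s \<in> fil d) \<Longrightarrow> sum f S \<in> fil d"
  by (simp add: fil_def ent_sum)

lemma fil_mono: "d \<le> d' \<Longrightarrow> x \<in> fil d' \<Longrightarrow> x \<in> fil d"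
  by (simp add: fil_def)

lemma fil_mult:
  assumes "x \<in> fil d" "y \<in> fil d'"
  shows "x * y \<in> fil (d + d')"
proof -
  have "ent x a k * ent y k b = 0" if "b < a + (d + d')" for a b k
  proof (cases "k < a + d")
    case False
    with that have "b < k + d'" by simp
    with assms(2) show ?thesis by (simp add: fil_def)
  qed (use assms(1) in \<open>simp add: fil_def\<close>)
  then show ?thesis by (simp add: fil_def ent_times sum.neutral)
qed

lemma fil_mult_left: "y \<in> fil d \<Longrightarrow> x * y \<in> fil d"
  and fil_mult_right: "y \<in> fil d \<Longrightarrow> y * x \<in> fil d"
  using fil_mult[of x 0 y d] fil_mult[of y d x 0] by simp_all

lemma fil_separated:
  assumes "\<And>d. x - y \<in> fil d"
  shows "x = y"
proof (rule tri_eqI)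
  fix a b
  show "ent x a b = ent y a b" using assms[of "Suc b"] by (simp add: fil_def)
qed

section \<open>Crossings of a nanophrase\<close>

definition linking :: "'a nanophrase \<Rightarrow> 'a \<Rightarrow> bool" where
  "linking p A \<longleftrightarrow> first_comp p A \<noteq> second_comp p A"

text \<open>The undercrossing is the occurrence that carries the nonzero sign. The index chosen by
  \<open>over_comp\<close> is the one used in \<open>eta\<close>.\<close>

definition under_comp :: "'a nanophrase \<Rightarrow> 'a \<Rightarrow> nat" where
  "under_comp p A = (if proj p A \<in> {b_plus, a_minus} then first_comp p A else second_comp p A)"

definition over_comp :: "'a nanophrase \<Rightarrow> 'a \<Rightarrow> nat" where
  "over_comp p A = (if proj p A \<in> {b_plus, a_minus} then second_comp p A else first_comp p A)"

definition positive :: "'a nanophrase \<Rightarrow> 'a \<Rightarrow> bool" where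
  "positive p A \<longleftrightarrow> proj p A \<in> {a_plus, b_plus}"

definition occs :: "'a nanophrase \<Rightarrow> 'a \<Rightarrow> (nat \<times> nat) set" where
  "occs p A = {r \<in> positions p. letter_at p r = A}"

lemma in_occs_iff: "x \<in> occs p A \<longleftrightarrow> x \<in> positions p \<and> letter_at p x = A"
  by (simp add: occs_def)

lemma card_occs: "card (occs p A) = count_list (concat (phrase p)) A"
proof -
  let ?ws = "phrase p"
  have "occs p A = (SIGMA i:{..<length ?ws}. {j. j < length (?ws ! i) \<and> ?ws ! i ! j = A})"
    by (auto simp: occs_def positions_def)
  then have "card (occs p A) = (\<Sum>i<length ?ws. card {j. j < length (?ws ! i) \<and> ?ws ! i ! j = A})"
    by (simp add: card_SigmaI)
  also have "\<dots> = (\<Sum>i<length ?ws. count_list (?ws ! i) A)"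
    by (simp add: count_list_eq_length_filter length_filter_conv_card eq_commute)
  also have "\<dots> = sum_list (map (\<lambda>w. count_list w A) ?ws)"
    by (simp add: sum_list_sum_nth atLeast0LessThan)
  also have "\<dots> = count_list (concat ?ws) A"
    by (simp add: count_list_concat)
  finally show ?thesis .
qed

lemma fst_occs: "fst ` occs p A = {i. i < length (phrase p) \<and> A \<in> set (phrase p ! i)}"
  by (force simp: occs_def positions_def in_set_conv_nth image_iff)

text \<open>The two positions are named so that \<open>r\<close> is the undercrossing. If both lie
  in one component, either naming fits.\<close>

lemma occs_cases:
  assumes "nanophrase n p" "A \<in> alphabet p"
  obtains r s where "occs p A = {r, s}" "r \<noteq> s" "fst r = under_comp p A" "fst s = over_comp p A"
    "linking p A \<longleftrightarrow> fst r \<noteq> fst s"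
    "first_comp p A = min (fst r) (fst s)" "second_comp p A = max (fst r) (fst s)"
proof -
  have "card (occs p A) = 2"
    using assms by (simp add: card_occs nanophrase_def)
  then obtain r s where rs: "occs p A = {r, s}" "r \<noteq> s" by (auto simp: card_2_iff)
  have fs: "first_comp p A = min (fst r) (fst s)" "second_comp p A = max (fst r) (fst s)"
    unfolding first_comp_def second_comp_def fst_occs[symmetric] rs by simp_all
  have "linking p A \<longleftrightarrow> fst r \<noteq> fst s"
    by (auto simp: linking_def fs)
  moreover have "(fst r = under_comp p A \<and> fst s = over_comp p A) \<or>
      (fst s = under_comp p A \<and> fst r = over_comp p A)"
    by (auto simp: under_comp_def over_comp_def fs min_def max_def)
  ultimately show ?thesis
    using that[of r s] that[of s r] rs fs by (auto simp: insert_commute min.commute max.commute)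
qed

lemma other_occ_eq:
  assumes "occs p A = {r, s}" "r \<noteq> s"
  shows "other_occ p r = s"
proof -
  have *: "x \<in> positions p \<and> letter_at p x = A \<longleftrightarrow> x = r \<or> x = s" for x
    using assms(1) by (simp add: in_occs_iff[symmetric])
  show ?thesis
    unfolding other_occ_def using * assms(2) by (intro the_equality) metis+
qed

lemma eps_eq:
  assumes p: "nanophrase n p" and r: "r \<in> positions p" and A: "A = letter_at p r"
  shows "eps p r = (if linking p A \<and> under_comp p A = fst r
    then (if positive p A then 1 else -1) else 0)"
proof -
  obtain i j where ij: "r = (i, j)" by fastforce
  then have "A \<in> set (concat (phrase p))"
    using r A by (auto simp: positions_def intro!: bexI[of _ "phrase p ! i"])
  then have "A \<in> alphabet p" using p by (auto simp: nanophrase_def)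
  then obtain u v where uv: "occs p A = {u, v}" "u \<noteq> v" "fst u = under_comp p A"
    "fst v = over_comp p A" "linking p A \<longleftrightarrow> fst u \<noteq> fst v"
    "first_comp p A = min (fst u) (fst v)" "second_comp p A = max (fst u) (fst v)"
    using occs_cases[OF p] by metis
  \<comment> \<open>\<open>eps\<close> compares component numbers, \<open>under_comp\<close> looks
    at the projection; this equivalence translates between them.\<close>
  have lt: "fst u < fst v \<longleftrightarrow> proj p A \<in> {b_plus, a_minus}" if "fst u \<noteq> fst v"
    using uv(3) that unfolding under_comp_def uv(6,7) by (auto split: if_splits)
  have eps: "eps p r =
      (if (fst r < fst (other_occ p r) \<and> proj p A = b_plus) \<or>
          (fst r > fst (other_occ p r) \<and> proj p A = a_plus) then 1
       else if (fst r < fst (other_occ p r) \<and> proj p A = a_minus) \<or>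
          (fst r > fst (other_occ p r) \<and> proj p A = b_minus) then -1 else 0)"
    unfolding eps_def Let_def A ..
  have "r \<in> occs p A" using r A by (simp add: in_occs_iff)
  then have "r = u \<or> r = v" using uv(1) by simp
  then show ?thesis
  proof
    assume r: "r = u"
    have "other_occ p u = v" using uv(1,2) by (simp add: other_occ_eq)
    then show ?thesis
      unfolding eps uv(5) uv(3)[symmetric] unfolding r using lt
      by (cases "fst u" "fst v" rule: linorder_cases; cases "proj p A"; simp add: positive_def)
  next
    assume r: "r = v"
    have "other_occ p v = u" using uv(1,2) by (simp add: other_occ_eq insert_commute)
    then show ?thesis
      unfolding eps uv(5) uv(3)[symmetric] unfolding r using lt
      by (cases "fst u" "fst v" rule: linorder_cases; cases "proj p A"; simp add: positive_def)
  qed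
qed

text \<open>No positions are needed: by \<open>eps_eq\<close> the sign of an occurrence depends only
  on its letter and its component.\<close>

definition signed :: "'a nanophrase \<Rightarrow> nat \<Rightarrow> 'a list \<Rightarrow> 'a sword" where
  "signed p i w =
     concat (map (\<lambda>A. if linking p A \<and> under_comp p A = i then [(A, positive p A)] else []) w)"

lemma signed_prefix_eq:
  assumes p: "nanophrase n p" and "i < n" "m \<le> length (phrase p ! i)"
  shows "signed_prefix p i m = signed p i (take m (phrase p ! i))"
proof -
  have take: "take m (phrase p ! i) = map ((!) (phrase p ! i)) [0..<m]"
    using assms(3) by (intro nth_equalityI) auto
  show ?thesis
    unfolding signed_prefix_def signed_def take map_map
  proof (intro arg_cong[of _ _ concat] map_cong refl)
    fix j assume "j \<in> set [0..<m]"
    then have "(i, j) \<in> positions p"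
      using assms by (auto simp: positions_def nanophrase_def)
    from eps_eq[OF p this refl] show "signed_letter p (i, j) =
      ((\<lambda>A. if linking p A \<and> under_comp p A = i then [(A, positive p A)] else [])
        \<circ> (!) (phrase p ! i)) j"
      by (auto simp: signed_letter_def)
  qed
qed

lemma signed_word_eq: "nanophrase n p \<Longrightarrow> i < n \<Longrightarrow> signed_word p i = signed p i (phrase p ! i)"
  by (simp add: signed_word_def signed_prefix_eq)

lemma nanophrase_in_alphabet:
  assumes "nanophrase n p" "k < n" "A \<in> set (phrase p ! k)"
  shows "A \<in> alphabet p"
  using assms by (force simp: nanophrase_def)

lemma comp_lt:
  assumes "nanophrase n p" "A \<in> alphabet p"
  shows "over_comp p A < n" "A \<in> set (phrase p ! over_comp p A)"
    "under_comp p A < n" "A \<in> set (phrase p ! under_comp p A)"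
proof -
  obtain r s where "occs p A = {r, s}" "fst r = under_comp p A" "fst s = over_comp p A"
    using occs_cases[OF assms] by metis
  then have "over_comp p A \<in> fst ` occs p A" "under_comp p A \<in> fst ` occs p A" by auto
  then show "over_comp p A < n" "A \<in> set (phrase p ! over_comp p A)"
    "under_comp p A < n" "A \<in> set (phrase p ! under_comp p A)"
    using assms(1) unfolding fst_occs by (auto simp: nanophrase_def)
qed

lemma linking_split:
  assumes p: "nanophrase n p" and "k < n" "phrase p ! k = pre @ A # post" "linking p A"
  shows "(k, m) \<in> occs p A \<longleftrightarrow> m = length pre"
proof -
  have "A \<in> alphabet p" using assms nanophrase_in_alphabet[OF p, of k A] by auto
  then obtain r s where rs: "occs p A = {r, s}" "fst r \<noteq> fst s"
    using occs_cases[OF p] assms(4) by metis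
  have "(k, length pre) \<in> occs p A"
    using assms by (auto simp: occs_def positions_def nanophrase_def)
  then show ?thesis using rs by force
qed

lemma linking_notin_prefix:
  assumes p: "nanophrase n p" and "k < n" "phrase p ! k = pre @ A # post" "linking p A"
  shows "A \<notin> set pre"
proof
  assume "A \<in> set pre"
  then obtain m where "m < length pre" "pre ! m = A" by (auto simp: in_set_conv_nth)
  then have "(k, m) \<in> occs p A"
    using assms by (auto simp: occs_def positions_def nanophrase_def nth_append)
  with linking_split[OF assms] \<open>m < length pre\<close> show False by auto
qed

lemma x_word_eq:
  assumes p: "nanophrase n p" and k: "k < n" "phrase p ! k = pre @ A # post"
    and A: "linking p A" "over_comp p A = k"
  shows "x_word p A = signed p k pre"
proof -
  have "A \<in> alphabet p" using k nanophrase_in_alphabet[OF p, of k A] by auto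
  then obtain r s where rs: "occs p A = {r, s}" "r \<noteq> s" "fst r = under_comp p A" "fst s = k"
     "fst r \<noteq> fst s"
    using occs_cases[OF p] A by metis
  have iff: "x \<in> positions p \<and> letter_at p x = A \<longleftrightarrow> x = r \<or> x = s" for x
    using rs(1) by (simp add: in_occs_iff[symmetric])
  have eps: "eps p r \<noteq> 0" "eps p s = 0"
    using eps_eq[OF p, of r A] eps_eq[OF p, of s A] iff[of r] iff[of s] rs A by auto
  have "signed_occ p A = r"
    unfolding signed_occ_def using iff eps by (intro the_equality) metis+
  moreover have "other_occ p r = s" using rs by (simp add: other_occ_eq)
  moreover have "s = (k, length pre)"
  proof -
    have "(k, snd s) \<in> occs p A" using rs by (cases s) simp
    then show ?thesis using linking_split[OF p k A(1)] rs(4) by (cases s) simp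
  qed
  ultimately show ?thesis
    using signed_prefix_eq[OF p k(1), of "length pre"] k by (simp add: x_word_def)
qed

section \<open>Meridians\<close>

text \<open>\<open>1 - M A\<close> plays the inverse of \<open>1 + M A\<close>, which it is as soon
  as \<open>M A\<close> squares to 0. So no inverses are required of the ring, and
  \<open>holonomy_inv\<close> is built separately from these candidates.\<close>

definition factor :: "'a nanophrase \<Rightarrow> ('a \<Rightarrow> 'r::ring_1) \<Rightarrow> nat \<Rightarrow> 'a \<Rightarrow> 'r" where
  "factor p M i A = (if linking p A \<and> under_comp p A = i
     then (if positive p A then 1 + M A else 1 - M A) else 1)"

definition ifactor :: "'a nanophrase \<Rightarrow> ('a \<Rightarrow> 'r::ring_1) \<Rightarrow> nat \<Rightarrow> 'a \<Rightarrow> 'r" where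
  "ifactor p M i A = (if linking p A \<and> under_comp p A = i
     then (if positive p A then 1 - M A else 1 + M A) else 1)"

definition holonomy :: "'a nanophrase \<Rightarrow> ('a \<Rightarrow> 'r::ring_1) \<Rightarrow> nat \<Rightarrow> 'a list \<Rightarrow> 'r" where
  "holonomy p M i w = prod_list (map (factor p M i) w)"

definition holonomy_inv :: "'a nanophrase \<Rightarrow> ('a \<Rightarrow> 'r::ring_1) \<Rightarrow> nat \<Rightarrow> 'a list \<Rightarrow> 'r" where
  "holonomy_inv p M i w = prod_list (map (ifactor p M i) (rev w))"

lemma holonomy_simps [simp]:
  "holonomy p M i [] = 1" "holonomy p M i (A # w) = factor p M i A * holonomy p M i w"
  "holonomy p M i (v @ w) = holonomy p M i v * holonomy p M i w"
  by (simp_all add: holonomy_def)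

lemma holonomy_inv_simps [simp]:
  "holonomy_inv p M i [] = 1" "holonomy_inv p M i (A # w) = holonomy_inv p M i w * ifactor p M i A"
  "holonomy_inv p M i (v @ w) = holonomy_inv p M i w * holonomy_inv p M i v"
  by (simp_all add: holonomy_inv_def)

text \<open>
  \<open>M A\<close> plays the role of $m - 1$, where $m$ is the meridian of the overcrossing arc at \<open>A\<close> and
  \<open>1 + t k\<close> that of the first arc of component \<open>k\<close>.
\<close>

definition meridians :: "'a nanophrase \<Rightarrow> (nat \<Rightarrow> 'r::ring_1) \<Rightarrow> ('a \<Rightarrow> 'r) \<Rightarrow> bool" where
  "meridians p t M \<longleftrightarrow> (\<forall>k pre A post. k < length (phrase p) \<longrightarrow> phrase p ! k = pre @ A # post \<longrightarrow>
     linking p A \<longrightarrow> over_comp p A = k \<longrightarrow> M A = holonomy_inv p M k pre * t k * holonomy p M k pre)"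

definition longitude :: "'a nanophrase \<Rightarrow> ('a \<Rightarrow> 'r::ring_1) \<Rightarrow> nat \<Rightarrow> 'r" where
  "longitude p M i = holonomy p M i (phrase p ! i)"

definition meridian_step :: "'a nanophrase \<Rightarrow> (nat \<Rightarrow> 'r::ring_1) \<Rightarrow> ('a \<Rightarrow> 'r) \<Rightarrow> 'a \<Rightarrow> 'r" where
  "meridian_step p t M A = (let k = over_comp p A; pre = takeWhile (\<lambda>B. B \<noteq> A) (phrase p ! k)
     in holonomy_inv p M k pre * t k * holonomy p M k pre)"

lemma takeWhile_neq: "A \<notin> set ys \<Longrightarrow> takeWhile (\<lambda>B. B \<noteq> A) (ys @ A # zs) = ys"
  by (induction ys) auto

text \<open>A linking letter occurs once in its over component, so the prefix in front of it is
  unique. The fixed-point form suits the contraction, the form with all splittings suits the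
  moves.\<close>

lemma meridians_iff_fixpoint:
  assumes p: "nanophrase n p"
  shows "meridians p t M \<longleftrightarrow> (\<forall>A\<in>alphabet p. linking p A \<longrightarrow> M A = meridian_step p t M A)"
proof (intro iffI ballI impI)
  fix A assume M: "meridians p t M" and A: "A \<in> alphabet p" "linking p A"
  let ?k = "over_comp p A"
  obtain post where "phrase p ! ?k = takeWhile (\<lambda>B. B \<noteq> A) (phrase p ! ?k) @ A # post"
    using split_list_first[OF comp_lt(2)[OF p A(1)]] takeWhile_neq by metis
  moreover have "?k < length (phrase p)"
    using comp_lt(1)[OF p A(1)] p by (simp add: nanophrase_def)
  ultimately show "M A = meridian_step p t M A"
    using M A(2) unfolding meridians_def meridian_step_def Let_def by blast
next
  assume M: "\<forall>A\<in>alphabet p. linking p A \<longrightarrow> M A = meridian_step p t M A"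
  have "M A = holonomy_inv p M k pre * t k * holonomy p M k pre"
    if k: "k < length (phrase p)" "phrase p ! k = pre @ A # post"
      and A: "linking p A" "over_comp p A = k" for k pre A post
  proof -
    have n: "k < n" using k p by (simp add: nanophrase_def)
    have "A \<in> alphabet p" using n k nanophrase_in_alphabet[OF p, of k A] by auto
    then have "M A = meridian_step p t M A" using M A by blast
    moreover have "takeWhile (\<lambda>B. B \<noteq> A) (phrase p ! k) = pre"
      using linking_notin_prefix[OF p n k(2) A(1)] k(2) by (simp add: takeWhile_neq)
    ultimately show ?thesis using A(2) by (simp add: meridian_step_def)
  qed
  then show "meridians p t M" unfolding meridians_def by blast
qed

section \<open>Contraction and existence of meridians\<close>

lemma mult_diff_mult_in_fil:
  fixes x y x' y' :: "'b::comm_ring_1 tri"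
  assumes "x - x' \<in> fil d" "y - y' \<in> fil d"
  shows "x * y - x' * y' \<in> fil d"
proof -
  have "x * y - x' * y' = (x - x') * y + x' * (y - y')" by (simp add: algebra_simps)
  then show ?thesis using assms by (simp add: fil_add fil_mult_left fil_mult_right)
qed

lemma holonomy_diff_in_fil:
  fixes M M' :: "'a \<Rightarrow> 'b::comm_ring_1 tri"
  assumes "\<And>A. A \<in> set w \<Longrightarrow> linking p A \<Longrightarrow> M A - M' A \<in> fil d"
  shows "holonomy p M i w - holonomy p M' i w \<in> fil d" "holonomy_inv p M i w - holonomy_inv p M' i
      w \<in> fil d"
proof -
  have fac: "factor p M i A - factor p M' i A \<in> fil d" "ifactor p M i A - ifactor p M' i A \<in> fil d"
    if "A \<in> set w" for A
    using assms[OF that] fil_uminus[of "M A - M' A" d] by (auto simp: factor_def ifactor_def)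
  show "holonomy p M i w - holonomy p M' i w \<in> fil d"
    using fac(1) by (induction w) (auto intro!: mult_diff_mult_in_fil)
  show "holonomy_inv p M i w - holonomy_inv p M' i w \<in> fil d"
    using fac(2) by (induction w) (auto intro!: mult_diff_mult_in_fil)
qed

text \<open>Changing the two conjugating factors one at a time leaves terms that contain both a
  difference in \<open>fil d\<close> and the generator \<open>t k\<close> in \<open>fil 1\<close>;
  this gains one level.\<close>

lemma meridian_step_contraction:
  fixes M M' :: "'a \<Rightarrow> 'b::comm_ring_1 tri"
  assumes p: "nanophrase n p" and t: "\<And>h. t h \<in> fil 1" and A: "A \<in> alphabet p"
    and M: "\<And>A. A \<in> alphabet p \<Longrightarrow> linking p A \<Longrightarrow> M A - M' A \<in> fil d"
  shows "meridian_step p t M A - meridian_step p t M' A \<in> fil (Suc d)"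
proof -
  define k where "k = over_comp p A"
  define pre where "pre = takeWhile (\<lambda>B. B \<noteq> A) (phrase p ! k)"
  have sub: "B \<in> set pre \<Longrightarrow> B \<in> alphabet p" for B
    using nanophrase_in_alphabet[OF p] comp_lt[OF p A] unfolding pre_def k_def
    by (metis set_takeWhileD)
  have d: "holonomy p M k pre - holonomy p M' k pre \<in> fil d" "holonomy_inv p M k pre -
      holonomy_inv p M' k pre \<in> fil d"
    using sub M by (auto intro!: holonomy_diff_in_fil)
  have "meridian_step p t M A - meridian_step p t M' A =
      (holonomy_inv p M k pre - holonomy_inv p M' k pre) * t k * holonomy p M k pre
      + holonomy_inv p M' k pre * (t k * (holonomy p M k pre - holonomy p M' k pre))"
    by (simp add: meridian_step_def Let_def k_def pre_def algebra_simps)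
  moreover have "(holonomy_inv p M k pre - holonomy_inv p M' k pre) * t k * holonomy p M k pre \<in>
      fil (Suc d)"
    using fil_mult[OF d(2) t, of k] by (simp add: fil_mult_right)
  moreover have "holonomy_inv p M' k pre * (t k * (holonomy p M k pre - holonomy p M' k pre)) \<in>
      fil (Suc d)"
    using fil_mult[OF t d(1), of k] by (simp add: fil_mult_left)
  ultimately show ?thesis by (simp add: fil_add)
qed

lemma cauchy_limit:
  fixes x :: "nat \<Rightarrow> 'b::comm_ring_1 tri"
  assumes "\<And>q. x (Suc q) - x q \<in> fil q"
  shows "\<exists>y. \<forall>q. x q - y \<in> fil q"
proof -
  have *: "x (q + m) - x q \<in> fil q" for q m
  proof (induction m)
    case (Suc m)
    have "x (q + Suc m) - x (q + m) \<in> fil q" using fil_mono[OF _ assms[of "q + m"], of q] by simp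
    from fil_add[OF this Suc] show ?case by simp
  qed simp
  have eq: "ent (x q) a b = ent (x q') a b" if "b < a + q" "q \<le> q'" for a b q q'
    using *[of q "q' - q"] that by (simp add: fil_def)
  \<comment> \<open>For every row \<open>a\<close>, the entry in column \<open>b\<close> is constant
    from index \<open>Suc b\<close> on.\<close>
  define y where "y = Abs_tri (\<lambda>a b. ent (x (Suc b)) a b)"
  have y: "ent y a b = ent (x (Suc b)) a b" for a b
    unfolding y_def by (subst Abs_tri_inverse) (auto simp: ent_below)
  have "x q - y \<in> fil q" for q
  proof -
    have "ent (x q) a b = ent (x (Suc b)) a b" if "b < a + q" for a b
    proof (cases "q \<le> Suc b")
      case True
      then show ?thesis by (rule eq[OF that])
    next
      case False
      then show ?thesis by (intro eq[symmetric]) auto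
    qed
    then show ?thesis by (simp add: fil_def y)
  qed
  then show ?thesis by blast
qed

lemma meridians_exist:
  fixes t :: "nat \<Rightarrow> 'b::comm_ring_1 tri"
  assumes p: "nanophrase n p" and t: "\<And>h. t h \<in> fil 1"
  obtains M where "meridians p t M"
proof -
  define F where "F q = (meridian_step p t ^^ q) (\<lambda>_. 0)" for q
  have F_Suc: "F (Suc q) = meridian_step p t (F q)" for q
    by (simp add: F_def)
  have F: "F (Suc q) A - F q A \<in> fil q" if "A \<in> alphabet p" for q A
    using that
  proof (induction q arbitrary: A)
    case (Suc q)
    have "meridian_step p t (F (Suc q)) A - meridian_step p t (F q) A \<in> fil (Suc q)"
      by (rule meridian_step_contraction[OF p t Suc.prems]) (rule Suc.IH)
    then show ?case by (simp only: F_Suc)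
  qed simp
  have "\<forall>A. \<exists>y. A \<in> alphabet p \<longrightarrow> (\<forall>q. F q A - y \<in> fil q)"
  proof
    fix A
    show "\<exists>y. A \<in> alphabet p \<longrightarrow> (\<forall>q. F q A - y \<in> fil q)"
    proof (cases "A \<in> alphabet p")
      case True
      have "\<exists>y. \<forall>q. F q A - y \<in> fil q"
        by (rule cauchy_limit) (rule F[OF True])
      then show ?thesis by blast
    qed simp
  qed
  from choice[OF this] obtain M where M: "\<And>A q. A \<in> alphabet p \<Longrightarrow> F q A - M A \<in> fil q"
    by blast
  have eq: "M A = meridian_step p t M A" if A: "A \<in> alphabet p" for A
  proof (rule fil_separated)
    fix d
    have "F (Suc d) A - meridian_step p t M A \<in> fil d"
    proof (rule fil_mono)
      have "meridian_step p t (F d) A - meridian_step p t M A \<in> fil (Suc d)"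
        by (rule meridian_step_contraction[OF p t A]) (rule M)
      then show "F (Suc d) A - meridian_step p t M A \<in> fil (Suc d)" by (simp only: F_Suc)
    qed simp
    moreover have "F (Suc d) A - M A \<in> fil d"
      using fil_mono[OF _ M[OF A], of d "Suc d"] by simp
    ultimately show "M A - meridian_step p t M A \<in> fil d"
      using fil_diff[of "F (Suc d) A - meridian_step p t M A" d "F (Suc d) A - M A"] by simp
  qed
  have "meridians p t M"
    unfolding meridians_iff_fixpoint[OF p] using eq by metis
  then show ?thesis by (rule that)
qed

section \<open>Evaluation of words\<close>

definition ev :: "(nat \<Rightarrow> 'r::ring_1) \<Rightarrow> nat sword \<Rightarrow> 'r" where
  "ev t w = prod_list (map (\<lambda>(h, s). if s then 1 + t h else 1 - t h) w)"

lemma ev_simps [simp]: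
  "ev t [] = 1" "ev t ((h, s) # w) = (if s then 1 + t h else 1 - t h) * ev t w"
  "ev t (v @ w) = ev t v * ev t w"
  by (simp_all add: ev_def)

lemma inv_word_append [simp]: "inv_word (v @ w) = inv_word w @ inv_word v"
  by (simp add: inv_word_def)

lemma inv_word_simps [simp]:
  "inv_word [] = []" "inv_word ((A, s) # w) = inv_word w @ [(A, \<not> s)]"
  by (simp_all add: inv_word_def)

lemma inv_word_inv_word [simp]: "inv_word (inv_word w) = w"
  by (auto simp: inv_word_def rev_map intro!: map_idI)

lemma eta_append [simp]: "eta p (v @ w) = eta p v @ eta p w"
  by (simp add: eta_def)

lemma eta_simps [simp]:
  "eta p [] = []" "eta p ((A, s) # w) = (over_comp p A, s) # eta p w"
  by (simp_all add: eta_def over_comp_def)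

lemma eta_inv_word: "eta p (inv_word w) = inv_word (eta p w)"
  by (simp add: eta_def inv_word_def rev_map case_prod_beta)

lemma rho_append [simp]: "rho p q (v @ w) = rho p q v @ rho p q w"
  by (subst (1 2 3) rho.simps) simp

lemma rho_Nil [simp]: "rho p q [] = []"
  by (subst rho.simps) simp

lemma rho_single: "rho p q [(A, s)] = (if q \<le> 2 then [(A, s)]
    else rho p (q - 1) (inv_word (x_word p A)) @ [(A, s)] @ rho p (q - 1) (x_word p A))"
  by (subst rho.simps) simp

lemma rho_Cons: "rho p q (x # w) = rho p q [x] @ rho p q w"
  using rho_append[of p q "[x]" w] by simp

lemma rho_inv_word: "rho p q (inv_word w) = inv_word (rho p q w)"
proof (induction q arbitrary: w rule: less_induct)
  case (less q)
  show ?case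
  proof (induction w)
    case (Cons x w)
    obtain A s where x: "x = (A, s)" by fastforce
    have "rho p q [(A, \<not> s)] = inv_word (rho p q [(A, s)])"
      using less[of "q - 1"] by (cases "q \<le> 2") (simp_all add: rho_single)
    then show ?case
      using Cons rho_Cons[of p q x w] by (simp add: x)
  qed simp
qed

lemma ev_inv_word:
  assumes "\<And>h. t h * t h = 0"
  shows "ev t w * ev t (inv_word w) = 1" "ev t (inv_word w) * ev t w = 1"
proof -
  have "ev t w * ev t (inv_word w) = 1 \<and> ev t (inv_word w) * ev t w = 1"
  proof (induction w)
    case (Cons x w)
    obtain h s where x: "x = (h, s)" by fastforce
    let ?f = "if s then 1 + t h else 1 - t h" and ?g = "if s then 1 - t h else 1 + t h"
    have fg: "?f * ?g = 1" "?g * ?f = 1"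
      using assms[of h] by (auto simp: algebra_simps)
    have "ev t (x # w) * ev t (inv_word (x # w)) = ?f * (ev t w * ev t (inv_word w)) * ?g"
      by (simp add: x mult.assoc)
    moreover have "ev t (inv_word (x # w)) * ev t (x # w) = ev t (inv_word w) * (?g * ?f) * ev t w"
      by (simp add: x mult.assoc)
    ultimately show ?case using Cons fg by simp
  qed simp
  then show "ev t w * ev t (inv_word w) = 1" "ev t (inv_word w) * ev t w = 1" by simp_all
qed

text \<open>What \<rho>^q assigns to the letter after evaluation, minus 1: conjugating
  \<open>1 + t\<close> or \<open>1 - t\<close> only conjugates \<open>t\<close>.\<close>

definition approx_meridian :: "'a nanophrase \<Rightarrow> (nat \<Rightarrow> 'r::ring_1) \<Rightarrow> nat \<Rightarrow> 'a \<Rightarrow> 'r" where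
  "approx_meridian p t q A = (if q \<le> 2 then t (over_comp p A)
     else ev t (eta p (rho p (q - 1) (inv_word (x_word p A)))) * t (over_comp p A) *
       ev t (eta p (rho p (q - 1) (x_word p A))))"

lemma ev_rho_single:
  assumes "\<And>h. t h * t h = 0"
  shows "ev t (eta p (rho p q [(A, s)])) =
    (if s then 1 + approx_meridian p t q A else 1 - approx_meridian p t q A)"
proof -
  have inv: "ev t (eta p (rho p (q - 1) (inv_word (x_word p A)))) *
      ev t (eta p (rho p (q - 1) (x_word p A))) = 1"
    by (simp add: rho_inv_word eta_inv_word ev_inv_word[OF assms])
  show ?thesis
    by (simp add: rho_single approx_meridian_def algebra_simps inv[simplified])
qed

lemma signed_simps [simp]:
  "signed p i [] = []"
  "signed p i (A # w) =
     (if linking p A \<and> under_comp p A = i then [(A, positive p A)] else []) @ signed p i w"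
  by (simp_all add: signed_def)

lemma ev_rho_signed:
  assumes "\<And>h. t h * t h = 0"
  shows "ev t (eta p (rho p q (signed p i w))) = holonomy p (approx_meridian p t q) i w"
    and "ev t (eta p (rho p q (inv_word (signed p i w)))) = holonomy_inv p (approx_meridian p t q)
        i w"
  by (induction w) (simp_all add: ev_rho_single[OF assms] factor_def ifactor_def)

text \<open>Raising \<open>q\<close> by one is one iteration of the meridian equations, because
  \<open>x_word\<close> is the signed prefix in front of the overcrossing. Hence \<rho>^q performs
  \<open>q - 2\<close> iterations starting from the generators.\<close>

lemma approx_meridian_Suc:
  assumes p: "nanophrase n p" and t: "\<And>h. t h * t h = 0" and q: "2 \<le> q"
    and A: "A \<in> alphabet p" "linking p A"
  shows "approx_meridian p t (Suc q) A = meridian_step p t (approx_meridian p t q) A"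
proof -
  define k where "k = over_comp p A"
  obtain post where post: "phrase p ! k = takeWhile (\<lambda>B. B \<noteq> A) (phrase p ! k) @ A # post"
    using split_list_first[OF comp_lt(2)[OF p A(1)]] takeWhile_neq unfolding k_def by metis
  have "x_word p A = signed p k (takeWhile (\<lambda>B. B \<noteq> A) (phrase p ! k))"
    by (rule x_word_eq[OF p _ post A(2)]) (simp_all add: k_def comp_lt(1)[OF p A(1)])
  then show ?thesis
    using q by (simp add: approx_meridian_def meridian_step_def Let_def k_def[symmetric]
      ev_rho_signed[OF t])
qed

lemma ev_rho_approximates_longitude:
  fixes t :: "nat \<Rightarrow> 'b::comm_ring_1 tri"
  assumes p: "nanophrase n p" and t: "\<And>h. t h * t h = 0" and fil: "\<And>h. t h \<in> fil 1"
    and M: "meridians p t M" and i: "i < n"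
  shows "ev t (eta p (rho p (d + 2) (signed_word p i))) - longitude p M i \<in> fil (Suc d)"
proof -
  have fixpoint: "M A = meridian_step p t M A" if "A \<in> alphabet p" "linking p A" for A
    using M that meridians_iff_fixpoint[OF p] by metis
  have approx: "approx_meridian p t (d + 2) A - M A \<in> fil (Suc d)"
    if "A \<in> alphabet p" "linking p A" for A
    using that
  proof (induction d arbitrary: A)
    \<comment> \<open>At \<open>q = 2\<close> nothing has been iterated, but generator and true
      meridian both lie in \<open>fil 1\<close>; hence the level \<open>Suc d\<close> for
      \<open>q = d + 2\<close>.\<close>
    case 0
    have "meridian_step p t M A \<in> fil 1"
      unfolding meridian_step_def Let_def by (intro fil_mult_left fil_mult_right fil)
    then have "M A \<in> fil 1" using fixpoint[OF 0] by simp
    moreover have "approx_meridian p t 2 A \<in> fil 1"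
      using fil by (simp add: approx_meridian_def)
    ultimately show ?case using fil_diff by (simp add: numeral_2_eq_2)
  next
    case (Suc d)
    have "approx_meridian p t (Suc (d + 2)) A = meridian_step p t (approx_meridian p t (d + 2)) A"
      by (rule approx_meridian_Suc[OF p t _ Suc.prems]) simp
    moreover have "meridian_step p t (approx_meridian p t (d + 2)) A - meridian_step p t M A
        \<in> fil (Suc (Suc d))"
      by (rule meridian_step_contraction[OF p fil Suc.prems(1)]) (rule Suc.IH)
    ultimately show ?case using fixpoint[OF Suc.prems] by simp
  qed
  show ?thesis
    unfolding signed_word_eq[OF p i] ev_rho_signed[OF t] longitude_def
    using nanophrase_in_alphabet[OF p i] by (intro holonomy_diff_in_fil(1) approx)
qed

section \<open>Coefficients as matrix entries\<close>

text \<open>Substitution of \<open>t h\<close> for \<kappa>_h in the terms of degree at most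
  \<open>N\<close>, in Horner form: \<open>f (h # m)\<close> as a function of \<open>m\<close> is
  the left quotient of the series by \<kappa>_h. No infinite sum of matrices is formed.\<close>

fun expand :: "nat \<Rightarrow> (nat \<Rightarrow> 'r::ring_1) \<Rightarrow> nat \<Rightarrow> nc_series \<Rightarrow> 'r" where
  "expand n t 0 f = of_int (f [])"
| "expand n t (Suc N) f = of_int (f []) + (\<Sum>h<n. t h * expand n t N (\<lambda>m. f (h # m)))"

lemma expand_add: "expand n t N (\<lambda>m. f m + g m) = expand n t N f + expand n t N g"
  by (induction N arbitrary: f g) (simp_all add: sum.distrib distrib_left)

lemma expand_zero: "expand n t N (\<lambda>m. 0) = 0"
  by (induction N) simp_all

lemma expand_Suc_diff:
  fixes t :: "nat \<Rightarrow> 'b::comm_ring_1 tri"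
  assumes fil: "\<And>h. t h \<in> fil 1"
  shows "expand n t (Suc N) f - expand n t N f \<in> fil (Suc N)"
proof (induction N arbitrary: f)
  case 0
  show ?case using fil_sum[OF fil_mult_right[OF fil]] by simp
next
  case (Suc N)
  have "expand n t (Suc (Suc N)) f - expand n t (Suc N) f = (\<Sum>h<n. t h *
      (expand n t (Suc N) (\<lambda>m. f (h # m)) - expand n t N (\<lambda>m. f (h # m))))"
    by (simp only: expand.simps sum_subtractf right_diff_distrib) simp
  moreover have "t h * (expand n t (Suc N) g - expand n t N g) \<in> fil (Suc (Suc N))" for h g
    using fil_mult[OF fil Suc] by simp
  ultimately show ?case by (simp only:) (rule fil_sum)
qed

text \<open>The hypothesis on \<open>f\<close> says that \<open>f\<close> is (1 + \<kappa>_h)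
  \<open>g\<close>. Truncation disturbs the product only in degree \<open>Suc N\<close>. Stated as a
  relation between two series, it also covers the inverse letter, with the two roles
  exchanged.\<close>

lemma expand_times_letter:
  fixes t :: "nat \<Rightarrow> 'b::comm_ring_1 tri"
  assumes fil: "\<And>h. t h \<in> fil 1" and n: "\<And>h. n \<le> h \<Longrightarrow> t h = 0"
    and f: "\<And>m. f m = g m + (case m of [] \<Rightarrow> 0 | x # m' \<Rightarrow> if x = h then g m' else 0)"
  shows "expand n t N f - (1 + t h) * expand n t N g \<in> fil (Suc N)"
proof (cases N)
  case 0
  then show ?thesis using fil_uminus[OF fil_mult_right[OF fil]] f[of "[]"]
    by (simp add: algebra_simps)
next
  case (Suc K)
  have "t x * expand n t K (\<lambda>m. f (x # m)) =
      t x * expand n t K (\<lambda>m. g (x # m)) + (if x = h then t x * expand n t K g else 0)" for x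
    by (simp add: f expand_add expand_zero distrib_left)
  then have "expand n t N f = expand n t N g + (\<Sum>x<n. if x = h then t x * expand n t K g else 0)"
    by (simp add: Suc f[of "[]"] sum.distrib del: sum.delta)
  also have "\<dots> = expand n t N g + t h * expand n t K g"
    using n[of h] by (cases "h < n") simp_all
  finally have "expand n t N f - (1 + t h) * expand n t N g =
      - (t h * (expand n t (Suc K) g - expand n t K g))"
    by (simp only: Suc) (simp add: algebra_simps del: expand.simps)
  moreover have "t h * (expand n t (Suc K) g - expand n t K g) \<in> fil (Suc N)"
    using fil_mult[OF fil expand_Suc_diff[OF fil]] by (simp add: Suc del: expand.simps)
  ultimately show ?thesis by (simp only:) (rule fil_uminus)
qed

lemma phi_letter_Nil [simp]: "phi_letter l [] = 1"
  by (cases l; cases "snd l") auto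

lemma phi_letter_True_times:
  "nc_times (phi_letter (h, True)) g m =
     g m + (case m of [] \<Rightarrow> 0 | x # m' \<Rightarrow> if x = h then g m' else 0)"
proof (cases m)
  case (Cons x m')
  have "nc_times (phi_letter (h, True)) g m =
      g m + (\<Sum>k\<le>length m'. phi_letter (h, True) (x # take k m') * g (drop k m'))"
    unfolding nc_times_def Cons by (simp add: sum.atMost_Suc_shift del: sum.atMost_Suc
        phi_letter.simps)
  also have "(\<Sum>k\<le>length m'. phi_letter (h, True) (x # take k m') * g (drop k m')) =
      (\<Sum>k\<le>length m'. if k = 0 then (if x = h then g m' else 0) else 0)"
    by (intro sum.cong) auto
  finally show ?thesis using Cons by simp
qed (simp add: nc_times_def)

text \<open>Multiplying the product with the inverse series by 1 + \<kappa>_h gives \<open>g\<close>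
  back, in exactly the shape that \<open>expand_times_letter\<close> expects.\<close>

lemma phi_letter_False_times:
  "g m = nc_times (phi_letter (h, False)) g m + (case m of [] \<Rightarrow> 0
     | x # m' \<Rightarrow> if x = h then nc_times (phi_letter (h, False)) g m' else 0)"
proof (cases m)
  case (Cons x m')
  have "nc_times (phi_letter (h, False)) g m =
      g m + (\<Sum>k\<le>length m'. phi_letter (h, False) (x # take k m') * g (drop k m'))"
    unfolding nc_times_def Cons by (simp add: sum.atMost_Suc_shift del: sum.atMost_Suc
        phi_letter.simps)
  also have "(\<Sum>k\<le>length m'. phi_letter (h, False) (x # take k m') * g (drop k m')) =
      (if x = h then - nc_times (phi_letter (h, False)) g m' else 0)"
    by (auto simp: nc_times_def sum_negf[symmetric] intro!: sum.cong sum.neutral)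
  finally show ?thesis using Cons by simp
qed (simp add: nc_times_def)

lemma ev_expand:
  fixes t :: "nat \<Rightarrow> 'b::comm_ring_1 tri"
  assumes fil: "\<And>h. t h \<in> fil 1" and sq: "\<And>h. t h * t h = 0" and n: "\<And>h. n \<le> h \<Longrightarrow> t h = 0"
  shows "ev t w - expand n t N (phi w) \<in> fil (Suc N)"
proof (induction w)
  case Nil
  have "expand n t N nc_one = 1"
    by (cases N) (simp_all add: nc_one_def expand_zero)
  then show ?case by simp
next
  case (Cons x w)
  obtain h s where x: "x = (h, s)" by fastforce
  show ?case
  proof (cases s)
    case True
    have "expand n t N (phi (x # w)) - (1 + t h) * expand n t N (phi w) \<in> fil (Suc N)"
      by (rule expand_times_letter[OF fil n]) (simp_all only: x True phi.simps
          phi_letter_True_times)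
    from fil_diff[OF fil_mult_left[OF Cons, of "1 + t h"] this] show ?thesis
      by (simp add: x True algebra_simps)
  next
    case False
    have "expand n t N (phi w) - (1 + t h) * expand n t N (phi (x # w)) \<in> fil (Suc N)"
      by (rule expand_times_letter[OF fil n]) (simp_all only: x False phi.simps, rule
          phi_letter_False_times)
    from fil_add[OF Cons this] have
      "(1 - t h) * (ev t w - (1 + t h) * expand n t N (phi (x # w))) \<in> fil (Suc N)"
      by (intro fil_mult_left) simp
    moreover have "(1 - t h) * ((1 + t h) * y) = y" for y
      using sq[of h] by (simp add: mult.assoc[symmetric]) (simp add: algebra_simps)
    ultimately show ?thesis
      by (simp add: x False right_diff_distrib)
  qed
qed

text \<open>
  The matrices \<open>t h\<close> of interest are conjugates of the elementary ones below; \<open>D\<close> selects the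
  residues modulo \<open>D\<close>.
\<close>

definition adapted :: "nat list \<Rightarrow> int \<Rightarrow> (nat \<Rightarrow> residues tri) \<Rightarrow> bool" where
  "adapted c D t \<longleftrightarrow>
     (\<forall>h a b. ent (t h) a b \<noteq> 0 \<longrightarrow> (\<exists>s. a \<le> s \<and> s < b \<and> s < length c \<and> c ! s = h)) \<and>
     (\<forall>s < length c. ent (t (c ! s)) s (Suc s) = idem D) \<and>
     (\<forall>h a b. ent (t h) a b * idem D = ent (t h) a b)"

lift_definition elementary :: "nat list \<Rightarrow> int \<Rightarrow> nat \<Rightarrow> residues tri" is
  "\<lambda>c D h a b. if b = Suc a \<and> a < length c \<and> c ! a = h then idem D else 0"
  by auto

lemma ent_elementary:
  "ent (elementary c D h) a b = (if b = Suc a \<and> a < length c \<and> c ! a = h then idem D else 0)"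
  by (simp add: elementary.rep_eq)

lemma adapted_elementary: "adapted c D (elementary c D)"
  unfolding adapted_def by (auto simp: ent_elementary split: if_splits intro!: exI)

lemma adapted_support:
  "adapted c D t \<Longrightarrow> ent (t h) a b \<noteq> 0 \<Longrightarrow> \<exists>s. a \<le> s \<and> s < b \<and> s < length c \<and> c ! s = h"
  unfolding adapted_def by blast

lemma adapted_fil: "adapted c D t \<Longrightarrow> t h \<in> fil 1"
  using adapted_support[of c D t h] unfolding fil_def by fastforce

lemma adapted_eq_0: "adapted c D t \<Longrightarrow> h \<notin> set c \<Longrightarrow> t h = 0"
  using adapted_support[of c D t h] by (intro tri_eqI) (auto simp: in_set_conv_nth)

text \<open>By distinctness only one place \<open>s\<close> carries \<open>h\<close>. The left
  factor ends in a column beyond \<open>s\<close>, the right one starts in a row not beyond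
  \<open>s\<close>, and a triangular \<open>x\<close> cannot lead back. This is the algebraic form
  of commuting conjugates.\<close>

lemma adapted_nil:
  assumes t: "adapted c D t" and c: "distinct c"
  shows "t h * (x * t h) = 0"
proof (rule tri_eqI)
  fix a b
  have "ent (t h) a k * (ent x k l * ent (t h) l b) = 0" for k l
  proof (cases "ent (t h) a k = 0 \<or> ent (t h) l b = 0")
    case False
    then obtain s s' where "s < k" "s < length c" "c ! s = h" "l \<le> s'" "s' < length c" "c ! s' = h"
      using adapted_support[OF t, of h a k] adapted_support[OF t, of h l b] by blast
    moreover from this have "s = s'" using nth_eq_iff_index_eq[OF c] by blast
    ultimately show ?thesis by (simp add: ent_below)
  qed auto
  then show "ent (t h * (x * t h)) a b = ent 0 a b"
    by (simp add: ent_times sum_distrib_left)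
qed

lemma ent_expand_diag:
  assumes "adapted c D t"
  shows "ent (expand n t N f) b b = of_int (f [])"
proof -
  have "ent (t h) b b = 0" for h
    using adapted_support[OF assms, of h b b] by force
  then show ?thesis by (cases N) (simp_all add: ent_of_int ent_sum ent_times)
qed

text \<open>The indices at places \<open>a\<close>, ..., \<open>b - 1\<close>: the monomial whose
  coefficient is found in entry \<open>(a, b)\<close>.\<close>

definition slice :: "nat list \<Rightarrow> nat \<Rightarrow> nat \<Rightarrow> nat list" where
  "slice c a b = take (b - a) (drop a c)"

lemma slice_simps:
  "a < b \<Longrightarrow> b \<le> length c \<Longrightarrow> slice c a b = c ! a # slice c (Suc a) b"
  "slice c b b = []"
  by (simp_all add: slice_def Cons_nth_drop_Suc[symmetric] take_Cons' Suc_diff_Suc)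

lemma length_slice: "b \<le> length c \<Longrightarrow> length (slice c a b) = b - a"
  by (simp add: slice_def)

text \<open>A generator leading from row \<open>a\<close> to column \<open>k\<close> uses some place
  \<open>s\<close> between them; the rest of the monomial belongs to the places from
  \<open>k\<close> on.\<close>

lemma slice_Cons_subseq:
  assumes "a \<le> s" "s < k" "k \<le> b" "b \<le> length c"
  shows "subseq (c ! s # slice c k b) (slice c a b)"
proof -
  have shrink: "subseq (slice c k b) (slice c j b)" if "j \<le> k" for j
    using that
  proof (induction rule: inc_induct)
    case (step j)
    then show ?case using assms by (simp add: slice_simps(1)[of j] list_emb_Cons)
  qed simp
  have s: "subseq (c ! s # slice c k b) (slice c s b)"
    using shrink[of "Suc s"] assms by (simp add: slice_simps(1)[of s])
  show ?thesis
    using assms(1)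
  proof (induction rule: inc_induct)
    case base
    show ?case by (rule s)
  next
    case (step j)
    have "slice c j b = c ! j # slice c (Suc j) b"
      using step.hyps assms by (intro slice_simps(1)) auto
    then show ?case using step.IH by (simp only: list_emb_Cons)
  qed
qed

text \<open>
  Only the monomials \<open>m\<close> that are subsequences of the slice contribute to the entry, and all but
  the full slice vanish, either modulo \<open>D\<close> or because \<open>t\<close> is concentrated on the superdiagonal.
\<close>

lemma ent_expand:
  assumes t: "adapted c D t" and c: "distinct c" "set c \<subseteq> {..<n}"
    and ab: "a < b" "b \<le> length c" "b - a \<le> N"
    and D: "(\<forall>h a b. ent (t h) a b \<noteq> 0 \<longrightarrow> b = Suc a) \<or>
      (\<forall>m. m \<noteq> [] \<longrightarrow> subseq m (slice c a b) \<longrightarrow> m \<noteq> slice c a b \<longrightarrow> D dvd f m)"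
  shows "ent (expand n t N f) a b = of_int (f (slice c a b)) * idem D"
  using ab D
proof (induction N arbitrary: f a)
  case (Suc K)
  note prems = Suc.prems(1-3)
  let ?super = "\<forall>h a b. ent (t h) a b \<noteq> 0 \<longrightarrow> b = Suc a"
  have one: "ent (t (c ! a)) a (Suc a) = idem D" and idem: "\<And>h a b. ent (t h) a b * idem D = ent
      (t h) a b"
    using t prems unfolding adapted_def by auto
  let ?E = "\<lambda>h k. ent (expand n t K (\<lambda>m. f (h # m))) k b"
  have summand: "ent (t h) a k * ?E h k =
      (if k = Suc a \<and> h = c ! a then of_int (f (slice c a b)) * idem D else 0)"
    if k: "k \<in> {a..b}" for h k
  proof (cases "ent (t h) a k = 0")
    case True
    then show ?thesis using one by auto
  next
    case False
    then obtain s where s: "a \<le> s" "s < k" "s < length c" "c ! s = h"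
      using adapted_support[OF t] by blast
    have sub: "subseq (h # slice c k b) (slice c a b)"
      using slice_Cons_subseq[of a s k b c] s k prems by simp
    \<comment> \<open>On the diagonal, \<open>k = b\<close>, the expansion has no factor
      \<open>idem D\<close>; the entry of \<open>t h\<close> supplies it.\<close>
    have E: "?E h k = (if k < b then of_int (f (h # slice c k b)) * idem D else of_int (f [h]))"
    proof (cases "k < b")
      case True
      have disj: "?super \<or> (\<forall>m. m \<noteq> [] \<longrightarrow> subseq m (slice c k b) \<longrightarrow> m \<noteq> slice c k b \<longrightarrow> D dvd f (h #
          m))"
      proof (rule disjE[OF Suc.prems(4)])
        assume D: "\<forall>m. m \<noteq> [] \<longrightarrow> subseq m (slice c a b) \<longrightarrow> m \<noteq> slice c a b \<longrightarrow> D dvd f m"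
        have "D dvd f (h # m)" if m: "subseq m (slice c k b)" "m \<noteq> slice c k b" for m
        proof -
          have "subseq (h # m) (h # slice c k b)" using m by simp
          then have "subseq (h # m) (slice c a b)" using sub subseq_order.trans by blast
          moreover have "h # m \<noteq> slice c a b"
          proof
            assume eq: "h # m = slice c a b"
            have "length m \<le> length (slice c k b)" "length m \<noteq> length (slice c k b)"
              using m list_emb_length subseq_same_length by blast+
            then show False
              using arg_cong[OF eq, of length] prems s by (simp add: length_slice)
          qed
          ultimately show ?thesis using D by blast
        qed
        then show ?thesis by blast
      qed blast
      have "?E h k = of_int (f (h # slice c k b)) * idem D"
        by (rule Suc.IH[OF True _ _ disj]) (use prems s in auto)
      then show ?thesis using True by simp
    next
      case False
      then show ?thesis using k by (simp add: ent_expand_diag[OF t])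
    qed
    \<comment> \<open>A jump over more than one diagonal skips an index, so the monomial is a proper
      subsequence and its coefficient a multiple of \<open>D\<close>. The entry of
      \<open>t h\<close>, being a multiple of \<open>idem D\<close>, kills it.\<close>
    have 0: "ent (t h) a k * of_int (f (h # slice c k b)) = 0" if "k \<noteq> Suc a"
    proof -
      have "\<not> ?super" using that False by blast
      moreover have "h # slice c k b \<noteq> slice c a b"
      proof
        assume "h # slice c k b = slice c a b"
        from arg_cong[OF this, of length] show False
          using that s k prems by (simp add: length_slice)
      qed
      ultimately have "D dvd f (h # slice c k b)" using Suc.prems(4) sub by blast
      then have "idem D * of_int (f (h # slice c k b)) = 0"
        by (simp only: of_int_mult_idem_eq_0 mult.commute[of "idem D"])
      then have "ent (t h) a k * idem D * of_int (f (h # slice c k b)) = 0"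
        by (simp only: mult.assoc mult_zero_right)
      then show ?thesis by (simp only: idem)
    qed
    show ?thesis
    proof (cases "k = Suc a")
      case True
      then have "s = a" using s by simp
      then have h: "h = c ! a" using s by simp
      have slice: "slice c a b = h # slice c k b"
        using slice_simps(1)[of a b c] prems True h by simp
      have "idem D * (of_int (f (h # slice c k b)) * idem D) = of_int (f (h # slice c k b)) * idem
          D"
        by (subst mult.left_commute) simp
      then show ?thesis
        unfolding E slice using True one h k
        by (cases "k = b") (simp_all add: slice_simps(2) mult.commute)
    next
      case False
      then have "ent (t h) a k * ?E h k = 0"
        unfolding E using 0 k
        by (cases "k = b") (simp_all add: slice_simps(2) mult.assoc[symmetric])
      then show ?thesis using False by simp
    qed
  qed
  have "c ! a < n" using c prems by (auto simp: subset_iff)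
  have "ent (expand n t (Suc K) f) a b = (\<Sum>h<n. \<Sum>k=a..b. ent (t h) a k * ?E h k)"
    using prems by (simp add: ent_of_int ent_sum ent_times)
  also have "\<dots> = (\<Sum>h<n. \<Sum>k=a..b. if k = Suc a then (if h = c ! a then of_int (f (slice c a b)) *
      idem D else 0) else 0)"
    by (intro sum.cong refl) (simp add: summand)
  also have "\<dots> = of_int (f (slice c a b)) * idem D"
    using \<open>c ! a < n\<close> prems by simp
  finally show ?case .
qed simp

lemma longitude_entry_approx:
  assumes p: "nanophrase n p" "i < n" and t: "adapted c D t" and c: "distinct c" "set c \<subseteq> {..<n}"
    and M: "meridians p t M" and ab: "a < b" "b \<le> length c" and q: "length c + 2 \<le> q"
    and f: "f = phi (eta p (rho p q (signed_word p i)))"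
    and D: "(\<forall>h a b. ent (t h) a b \<noteq> 0 \<longrightarrow> b = Suc a) \<or>
      (\<forall>m. m \<noteq> [] \<longrightarrow> subseq m (slice c a b) \<longrightarrow> m \<noteq> slice c a b \<longrightarrow> D dvd f m)"
  shows "ent (longitude p M i) a b = of_int (f (slice c a b)) * idem D"
proof -
  define w where "w = eta p (rho p q (signed_word p i))"
  have sq: "t h * t h = 0" for h
    using adapted_nil[OF t c(1), of h 1] by simp
  have zero: "t h = 0" if "n \<le> h" for h
    using adapted_eq_0[OF t, of h] c that by force
  \<comment> \<open>The iteration error lies in \<open>fil (q - 1)\<close> and the truncation error
    in \<open>fil (length c + 1)\<close>; both vanish in all columns
    \<open>b \<le> length c\<close>.\<close>
  have "q - 2 + 2 = q" using q by simp
  then have "ev t w - longitude p M i \<in> fil (Suc (q - 2))"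
    using ev_rho_approximates_longitude[OF p(1) sq adapted_fil[OF t] M p(2), of "q - 2"]
    by (simp add: w_def)
  moreover have "ev t w - expand n t (length c) (phi w) \<in> fil (Suc (length c))"
    by (rule ev_expand[OF adapted_fil[OF t] sq zero])
  ultimately have "ent (longitude p M i) a b = ent (expand n t (length c) (phi w)) a b"
    using ab q by (simp add: fil_def)
  also have "\<dots> = of_int (f (slice c a b)) * idem D"
    unfolding w_def f[symmetric] by (rule ent_expand[OF t c ab _ D]) (use ab in simp)
  finally show ?thesis .
qed

lemma slice_full: "slice c 0 (length c) = c"
  by (simp add: slice_def)

lemma elementary_superdiagonal: "ent (elementary c D h) a b \<noteq> 0 \<Longrightarrow> b = Suc a"
  by (auto simp: ent_elementary split: if_splits)

text \<open>The value in \<open>mu\<close> is a definite description, so constancy in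
  \<open>q\<close> must be proved. The corner entry of the longitude is independent of
  \<open>q\<close>, and at \<open>D\<close> = 0 it determines the integer coefficient.\<close>

lemma eventually_mu:
  assumes p: "nanophrase n p" "i < n" and c: "distinct c" "set c \<subseteq> {..<n}" "c \<noteq> []"
  shows "\<forall>\<^sub>F q in sequentially. phi (eta p (rho p q (signed_word p i))) c = mu p c i"
proof -
  let ?f = "\<lambda>q. phi (eta p (rho p q (signed_word p i))) c"
  have t: "adapted c 0 (elementary c 0)" by (rule adapted_elementary)
  obtain M where M: "meridians p (elementary c 0) M"
    by (rule meridians_exist[OF p(1) adapted_fil[OF t]])
  have entry: "ent (longitude p M i) 0 (length c) = of_int (?f q) * idem 0" if "length c + 2 \<le> q"
      for q
  proof -
    have "ent (longitude p M i) 0 (length c) =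
        of_int (phi (eta p (rho p q (signed_word p i))) (slice c 0 (length c))) * idem 0"
      by (rule longitude_entry_approx[OF p t c(1,2) M _ order_refl that refl])
        (use c(3) in simp, intro disjI1 allI impI, erule elementary_superdiagonal)
    then show ?thesis by (simp only: slice_full)
  qed
  have const: "?f q = ?f (length c + 2)" if "length c + 2 \<le> q" for q
  proof -
    have "[?f q = ?f (length c + 2)] (mod 0)"
      unfolding of_int_mult_idem_eq_iff[symmetric]
      by (rule trans[OF entry[OF that, symmetric] entry[OF order_refl]])
    then show ?thesis by (simp only: cong_0)
  qed
  have ev: "\<forall>\<^sub>F q in sequentially. ?f q = ?f (length c + 2)"
    unfolding eventually_sequentially by (intro exI[of _ "length c + 2"] allI impI const)
  have "mu p c i = ?f (length c + 2)"
    unfolding mu_def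
  proof (rule the_equality, rule ev)
    fix m assume "\<forall>\<^sub>F q in sequentially. ?f q = m"
    from eventually_conj[OF this ev] have "\<forall>\<^sub>F q in sequentially. m = ?f (length c + 2)"
      by (rule eventually_mono) (elim conjE, rule trans[OF sym])
    then show "m = ?f (length c + 2)" by simp
  qed
  with ev show ?thesis by (simp only:)
qed

lemma longitude_entry:
  assumes p: "nanophrase n p" "i < n" and t: "adapted c D t" and c: "distinct c" "set c \<subseteq> {..<n}"
    and M: "meridians p t M" and ab: "a < b" "b \<le> length c"
    and D: "(\<forall>h a b. ent (t h) a b \<noteq> 0 \<longrightarrow> b = Suc a) \<or>
      (\<forall>m. m \<noteq> [] \<longrightarrow> subseq m (slice c a b) \<longrightarrow> m \<noteq> slice c a b \<longrightarrow> D dvd mu p m i)"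
  shows "ent (longitude p M i) a b = of_int (mu p (slice c a b) i) * idem D"
proof -
  let ?f = "\<lambda>q. phi (eta p (rho p q (signed_word p i)))"
  have sub: "distinct m" "set m \<subseteq> {..<n}" if "subseq m (slice c a b)" for m
  proof -
    have "distinct (slice c a b)" "set (slice c a b) \<subseteq> {..<n}"
      using c by (auto simp: slice_def dest!: in_set_takeD in_set_dropD)
    then show "distinct m" "set m \<subseteq> {..<n}"
      using that set_nths_subset by (force simp: subseq_conv_nths)+
  qed
  \<comment> \<open>One \<open>q\<close> must serve all subsequences at once; there are finitely
    many.\<close>
  have "\<forall>\<^sub>F q in sequentially. \<forall>m \<in> {m. m \<noteq> [] \<and> subseq m (slice c a b)}. ?f q m = mu p m i"
  proof (rule eventually_ball_finite)
    have "{m. m \<noteq> [] \<and> subseq m (slice c a b)} \<subseteq> set (subseqs (slice c a b))" by auto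
    then show "finite {m. m \<noteq> [] \<and> subseq m (slice c a b)}" using finite_subset by blast
    show "\<forall>m\<in>{m. m \<noteq> [] \<and> subseq m (slice c a b)}. \<forall>\<^sub>F q in sequentially. ?f q m = mu p m i"
      using eventually_mu[OF p] sub by blast
  qed
  from eventually_conj[OF this eventually_ge_at_top[of "length c + 2"]]
  obtain q where q: "length c + 2 \<le> q"
    and f: "\<And>m. m \<noteq> [] \<Longrightarrow> subseq m (slice c a b) \<Longrightarrow> ?f q m = mu p m i"
    using eventually_happens'[OF sequentially_bot] by blast
  have "slice c a b \<noteq> []" using ab by (simp add: slice_def)
  then have mu: "?f q (slice c a b) = mu p (slice c a b) i"
    by (rule f) simp
  have disj: "(\<forall>h a b. ent (t h) a b \<noteq> 0 \<longrightarrow> b = Suc a) \<or>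
      (\<forall>m. m \<noteq> [] \<longrightarrow> subseq m (slice c a b) \<longrightarrow> m \<noteq> slice c a b \<longrightarrow> D dvd ?f q m)"
  proof (rule disjE[OF D])
    assume *: "\<forall>m. m \<noteq> [] \<longrightarrow> subseq m (slice c a b) \<longrightarrow> m \<noteq> slice c a b \<longrightarrow> D dvd mu p m i"
    have "D dvd ?f q m" if "m \<noteq> []" "subseq m (slice c a b)" "m \<noteq> slice c a b" for m
      unfolding f[OF that(1,2)] using * that by blast
    then show ?thesis by blast
  qed (rule disjI1)
  show ?thesis
    unfolding mu[symmetric] by (rule longitude_entry_approx[OF p t c M ab q refl disj])
qed

section \<open>Moves that preserve the meridian of the first arc\<close>

text \<open>\<open>M A\<close> has the form \<open>v * t k * u\<close> and inherits the property of
  \<open>t k\<close>. With \<open>x\<close> = 1 it makes \<open>ifactor\<close> the inverse of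
  \<open>factor\<close>.\<close>

lemma meridian_nil:
  assumes p: "nanophrase n p" and nil: "\<And>h x. t h * (x * t h) = 0" and M: "meridians p t M"
    and A: "A \<in> alphabet p" "linking p A"
  shows "M A * (x * M A) = 0"
proof -
  obtain v u k where MA: "M A = v * t k * u"
    using M A unfolding meridians_iff_fixpoint[OF p] meridian_step_def Let_def by metis
  have "M A * (x * M A) = v * (t k * ((u * x * v) * t k)) * u"
    by (simp only: MA mult.assoc)
  then show ?thesis by (simp only: nil) simp
qed

lemma factor_inverse:
  assumes "linking p A \<Longrightarrow> M A * M A = 0"
  shows "factor p M i A * ifactor p M i A = 1" "ifactor p M i A * factor p M i A = 1"
  using assms by (auto simp: factor_def ifactor_def algebra_simps)

lemma mult_inverse_pair:
  fixes g :: "'r::ring_1"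
  assumes "g * g' = 1" "h * h' = 1"
  shows "g * h * (h' * g') = 1"
proof -
  have "g * h * (h' * g') = g * (h * h') * g'" by (simp only: mult.assoc)
  with assms show ?thesis by simp
qed

lemma holonomy_inverse:
  assumes "\<And>A. A \<in> set w \<Longrightarrow> linking p A \<Longrightarrow> M A * M A = 0"
  shows "holonomy p M i w * holonomy_inv p M i w = 1" "holonomy_inv p M i w * holonomy p M i w = 1"
proof -
  have "holonomy p M i w * holonomy_inv p M i w = 1 \<and> holonomy_inv p M i w * holonomy p M i w = 1"
    using assms by (induction w) (simp_all add: mult_inverse_pair factor_inverse)
  then show "holonomy p M i w * holonomy_inv p M i w = 1" "holonomy_inv p M i w * holonomy p M i w
      = 1" by simp_all
qed

text \<open>
  \<open>walk\<close> reads the phrase with its separators; \<open>g\<close> and \<open>g'\<close> are the value of the word read so far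
  in component \<open>i\<close> and its inverse.  Where \<open>t i \<noteq> 0\<close> the longitude is not recorded, since it
  changes under the third move if two of the three strands lie in component \<open>i\<close>.
\<close>

fun walk :: "'a nanophrase \<Rightarrow> (nat \<Rightarrow> 'r::ring_1) \<Rightarrow> ('a \<Rightarrow> 'r) \<Rightarrow> (nat \<Rightarrow> 'r) \<Rightarrow>
    nat \<Rightarrow> 'r \<Rightarrow> 'r \<Rightarrow> 'a option list \<Rightarrow> bool" where
  "walk p t M L i g g' [] \<longleftrightarrow> (t i = 0 \<longrightarrow> L i = g)"
| "walk p t M L i g g' (None # z) \<longleftrightarrow> (t i = 0 \<longrightarrow> L i = g) \<and> walk p t M L (Suc i) 1 1 z"
| "walk p t M L i g g' (Some A # z) \<longleftrightarrow> (linking p A \<longrightarrow> over_comp p A = i \<longrightarrow> M A = g' * t i * g) \<and>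
     walk p t M L i (g * factor p M i A) (ifactor p M i A * g') z"

lemma walk_word:
  "walk p t M L i g g' (map Some w @ z) \<longleftrightarrow>
     (\<forall>pre A post. w = pre @ A # post \<longrightarrow> linking p A \<longrightarrow> over_comp p A = i \<longrightarrow>
        M A = (holonomy_inv p M i pre * g') * t i * (g * holonomy p M i pre)) \<and>
     walk p t M L i (g * holonomy p M i w) (holonomy_inv p M i w * g') z"
proof (induction w arbitrary: g g')
  case (Cons B w)
  have split: "(\<forall>pre A post. B # w = pre @ A # post \<longrightarrow> Q pre A) \<longleftrightarrow>
      Q [] B \<and> (\<forall>pre A post. w = pre @ A # post \<longrightarrow> Q (B # pre) A)" for Q
    by (auto simp: Cons_eq_append_conv)
  show ?case
    by (simp only: split list.map append_Cons walk.simps Cons holonomy_simps holonomy_inv_simps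
        mult.assoc
      mult_1_left mult_1_right conj_assoc)
qed simp

lemma walk_flat:
  assumes "ws \<noteq> []"
  shows "walk p t M L i 1 1 (flat ws) \<longleftrightarrow> (\<forall>k<length ws.
     (\<forall>pre A post. ws ! k = pre @ A # post \<longrightarrow> linking p A \<longrightarrow> over_comp p A = i + k \<longrightarrow>
        M A = holonomy_inv p M (i + k) pre * t (i + k) * holonomy p M (i + k) pre) \<and>
     (t (i + k) = 0 \<longrightarrow> L (i + k) = holonomy p M (i + k) (ws ! k)))"
  using assms
proof (induction ws arbitrary: i rule: flat.induct)
  case (2 w)
  show ?case using walk_word[of p t M L i 1 1 w "[]"] by simp
next
  case (3 w v ws)
  have IH: "walk p t M L (Suc i) 1 1 (flat (v # ws)) \<longleftrightarrow> (\<forall>k<length (v # ws).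
     (\<forall>pre A post. (v # ws) ! k = pre @ A # post \<longrightarrow> linking p A \<longrightarrow> over_comp p A = Suc i + k \<longrightarrow>
        M A = holonomy_inv p M (Suc i + k) pre * t (Suc i + k) * holonomy p M (Suc i + k) pre) \<and>
     (t (Suc i + k) = 0 \<longrightarrow> L (Suc i + k) = holonomy p M (Suc i + k) ((v # ws) ! k)))"
    by (rule 3) simp
  show ?case
    unfolding flat.simps walk_word walk.simps IH length_Cons All_less_Suc2[where n = "Suc (length
        ws)"]
    by simp
qed simp

text \<open>\<open>walk\<close> restates the equations, with the longitudes where the generator
  vanishes, as a condition on the flat phrase, which the moves can cut anywhere. With
  \<open>n\<close> = 0 the flat phrase looks like a single empty component, and the walk would ask
  for its longitude.\<close>

lemma walk_iff:
  assumes p: "nanophrase n p" and n: "0 < n"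
  shows "walk p t M L 0 1 1 (flat (phrase p)) \<longleftrightarrow>
    meridians p t M \<and> (\<forall>i<n. t i = 0 \<longrightarrow> L i = longitude p M i)"
proof -
  have "phrase p \<noteq> []" "length (phrase p) = n" using p n by (auto simp: nanophrase_def)
  then show ?thesis
    unfolding walk_flat[OF \<open>phrase p \<noteq> []\<close>] meridians_def longitude_def add_0_left by blast
qed

text \<open>In component \<open>i\<close> the value \<open>g\<close> matters only through the conjugate of \<open>t i\<close>.\<close>

lemma walk_change_value:
  assumes "walk p t M L i g g' z" "t i * g = t i * h" "g' * t i = h' * t i" "t i = 0 \<Longrightarrow> g = h"
  shows "walk p t M L i h h' z"
  using assms
proof (induction z arbitrary: g g' h h' i)
  case (Cons a z)
  show ?case
  proof (cases a)
    case None
    then show ?thesis using Cons.prems by auto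
  next
    case (Some A)
    have "g' * t i * g = h' * t i * h"
      using Cons.prems(2,3) by (metis mult.assoc)
    moreover have "walk p t M L i (h * factor p M i A) (ifactor p M i A * h') z"
    proof (rule Cons.IH)
      show "walk p t M L i (g * factor p M i A) (ifactor p M i A * g') z"
        using Cons.prems(1) Some by simp
    qed (use Cons.prems(2-4) in \<open>simp_all add: mult.assoc[symmetric]\<close>,
         simp_all add: mult.assoc)
    ultimately show ?thesis using Cons.prems(1) Some by simp
  qed
qed auto

section \<open>Cutting and rejoining walks\<close>

definition agree :: "'a nanophrase \<Rightarrow> 'a nanophrase \<Rightarrow> ('a \<Rightarrow> 'r) \<Rightarrow> ('a \<Rightarrow> 'r) \<Rightarrow> 'a \<Rightarrow> bool" where
  "agree p p' M M' A \<longleftrightarrow> (linking p' A \<longleftrightarrow> linking p A) \<and> under_comp p' A = under_comp p A \<and>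
     over_comp p' A = over_comp p A \<and> (positive p' A \<longleftrightarrow> positive p A) \<and> M' A = M A"

lemma agree_factor:
  "agree p p' M M' A \<Longrightarrow> factor p' M' i A = factor p M i A"
  "agree p p' M M' A \<Longrightarrow> ifactor p' M' i A = ifactor p M i A"
  by (auto simp: agree_def factor_def ifactor_def)

text \<open>With \<open>ival\<close>, the state in which \<open>walk\<close> leaves a stretch of the
  flat phrase.\<close>

fun val :: "'a nanophrase \<Rightarrow> ('a \<Rightarrow> 'r::ring_1) \<Rightarrow> nat \<Rightarrow> 'r \<Rightarrow> 'a option list \<Rightarrow> 'r" where
  "val p M i g [] = g"
| "val p M i g (None # x) = val p M (Suc i) 1 x"
| "val p M i g (Some A # x) = val p M i (g * factor p M i A) x"

fun ival :: "'a nanophrase \<Rightarrow> ('a \<Rightarrow> 'r::ring_1) \<Rightarrow> nat \<Rightarrow> 'r \<Rightarrow> 'a option list \<Rightarrow> 'r" where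
  "ival p M i g [] = g"
| "ival p M i g (None # x) = ival p M (Suc i) 1 x"
| "ival p M i g (Some A # x) = ival p M i (ifactor p M i A * g) x"

lemma val_inverse:
  assumes "\<And>A. Some A \<in> set x \<Longrightarrow> linking p A \<Longrightarrow> M A * M A = 0" "g * g' = 1"
  shows "val p M i g x * ival p M i g' x = 1"
  using assms
proof (induction x arbitrary: i g g')
  case (Cons a x)
  show ?case
  proof (cases a)
    case None
    have "val p M (Suc i) 1 x * ival p M (Suc i) 1 x = 1"
      by (rule Cons.IH) (use Cons.prems(1) in simp_all)
    then show ?thesis using None by simp
  next
    case (Some A)
    have "val p M i (g * factor p M i A) x * ival p M i (ifactor p M i A * g') x = 1"
      using Cons.prems factor_inverse(1)[of p A M i] Some
      by (intro Cons.IH) (simp_all add: mult_inverse_pair)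
    then show ?thesis using Some by simp
  qed
qed simp

lemma walk_suffix:
  assumes "walk p t M L i g g' (x @ y)"
  shows "walk p t M L (i + count_list x None) (val p M i g x) (ival p M i g' x) y"
  using assms
proof (induction x arbitrary: i g g')
  case (Cons a x)
  show ?case
  proof (cases a)
    case None
    then show ?thesis using Cons.IH[of "Suc i" 1 1] Cons.prems by simp
  next
    case (Some A)
    then show ?thesis using Cons.IH[of i "g * factor p M i A" "ifactor p M i A * g'"] Cons.prems
      by simp
  qed
qed simp

text \<open>The stretch after a cut sees only the state at the cut. So a tail may be exchanged, even
  for one of another nanophrase, if the letters before the cut keep their data.\<close>

lemma walk_prefix:
  assumes "walk p t M L i g g' (x @ y)" "\<And>A. Some A \<in> set x \<Longrightarrow> agree p p' M M' A"
    and "walk p' t M' L (i + count_list x None) (val p M i g x) (ival p M i g' x) y'"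
  shows "walk p' t M' L i g g' (x @ y')"
  using assms
proof (induction x arbitrary: i g g')
  case (Cons a x)
  show ?case
  proof (cases a)
    case None
    then show ?thesis using Cons.IH[of "Suc i" 1 1] Cons.prems by simp
  next
    case (Some A)
    then have A: "agree p p' M M' A" using Cons.prems(2) by simp
    have "walk p' t M' L i (g * factor p M i A) (ifactor p M i A * g') (x @ y')"
      by (rule Cons.IH) (use Cons.prems Some in simp_all)
    then show ?thesis
      using Cons.prems(1) Some A by (simp add: agree_factor) (simp add: agree_def)
  qed
qed simp

lemma walk_agree:
  assumes "walk p t M L i g g' z" "\<And>A. Some A \<in> set z \<Longrightarrow> agree p p' M M' A"
  shows "walk p' t M' L i g g' z"
  using assms
proof (induction z arbitrary: i g g')
  case (Cons a z)
  show ?case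
  proof (cases a)
    case None
    have "walk p' t M' L (Suc i) 1 1 z"
      by (rule Cons.IH) (use Cons.prems None in simp_all)
    then show ?thesis using Cons.prems(1) None by simp
  next
    case (Some A)
    then have A: "agree p p' M M' A" using Cons.prems(2) by simp
    have "walk p' t M' L i (g * factor p M i A) (ifactor p M i A * g') z"
      by (rule Cons.IH) (use Cons.prems Some in simp_all)
    then show ?thesis
      using Cons.prems(1) Some A by (simp add: agree_factor) (simp add: agree_def)
  qed
qed simp

section \<open>Components of a letter in the flat phrase\<close>

fun flat_comps :: "nat \<Rightarrow> 'a option list \<Rightarrow> 'a \<Rightarrow> nat set" where
  "flat_comps i [] A = {}"
| "flat_comps i (None # z) A = flat_comps (Suc i) z A"
| "flat_comps i (Some B # z) A = (if B = A then {i} else {}) \<union> flat_comps i z A"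

lemma flat_comps_append:
  "flat_comps i (x @ y) A = flat_comps i x A \<union> flat_comps (i + count_list x None) y A"
  by (induction i x A rule: flat_comps.induct) auto

lemma flat_comps_empty: "Some A \<notin> set x \<Longrightarrow> flat_comps i x A = {}"
  by (induction i x A rule: flat_comps.induct) auto

lemma flat_comps_word: "flat_comps i (map Some w) A = (if A \<in> set w then {i} else {})"
  by (induction w) auto

lemma Collect_less_Suc:
  "{k. k < Suc m \<and> P k} = (if P 0 then {0} else {}) \<union> Suc ` {k. k < m \<and> P (Suc k)}"
  by (auto simp: less_Suc_eq_0_disj)

lemma flat_comps_flat:
  "flat_comps i (flat ws) A = (+) i ` {k. k < length ws \<and> A \<in> set (ws ! k)}"
proof (induction ws arbitrary: i rule: flat.induct)
  case (2 w)
  show ?case by (auto simp: flat_comps_word)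
next
  case (3 w v ws)
  have "flat_comps i (flat (w # v # ws)) A =
      (if A \<in> set w then {i} else {}) \<union> flat_comps (Suc i) (flat (v # ws)) A"
    by (simp add: flat_comps_append flat_comps_word count_list_0_iff)
  also have "flat_comps (Suc i) (flat (v # ws)) A =
      (+) i ` Suc ` {k. k < length (v # ws) \<and> A \<in> set ((w # v # ws) ! Suc k)}"
    unfolding 3 image_image by simp
  also have "(if A \<in> set w then {i} else {}) \<union> \<dots> =
      (+) i ` {k. k < length (w # v # ws) \<and> A \<in> set ((w # v # ws) ! k)}"
    unfolding length_Cons[of w] Collect_less_Suc by simp
  finally show ?case .
qed simp

text \<open>Since \<open>flat_comps\<close> splits over concatenation, first and second components
  can be read from the pieces into which a move cuts the phrase.\<close>

lemma comps_eq_flat_comps: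
  "first_comp p A = Min (flat_comps 0 (flat (phrase p)) A)"
  "second_comp p A = Max (flat_comps 0 (flat (phrase p)) A)"
  by (simp_all add: first_comp_def second_comp_def flat_comps_flat)

lemma agreeI:
  assumes "flat_comps 0 (flat (phrase p')) A = flat_comps 0 (flat (phrase p)) A"
    and "proj p' A = proj p A" "M' A = M A"
  shows "agree p p' M M' A"
  using assms
  by (simp add: agree_def linking_def under_comp_def over_comp_def positive_def comps_eq_flat_comps)

lemma count_flat: "count_list (flat ws) (Some A) = count_list (concat ws) A"
proof -
  have map: "count_list (map Some w) (Some A) = count_list w A" for w :: "'a list"
    by (induction w) auto
  show ?thesis by (induction ws rule: flat.induct) (simp_all add: map)
qed

lemma set_flat: "Some A \<in> set (flat ws) \<longleftrightarrow> A \<in> set (concat ws)"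
  by (induction ws rule: flat.induct) auto

lemma flat_letter:
  assumes "nanophrase n p" "Some A \<in> set (flat (phrase p))"
  shows "A \<in> alphabet p" "count_list (flat (phrase p)) (Some A) = 2"
  using assms by (auto simp: nanophrase_def count_flat set_flat)

text \<open>No separator stands between the two occurrences of the deleted letter, so it is not
  linking and contributes only factors 1.\<close>

lemma H1_meridians:
  fixes t :: "nat \<Rightarrow> 'r::ring_1"
  assumes p: "nanophrase n p" and p': "nanophrase n p'" and n: "0 < n" and H1: "H1_move p p'"
    and M: "meridians p t M"
  shows "meridians p' t M \<and> (\<forall>i<n. t i = 0 \<longrightarrow> longitude p' M i = longitude p M i)"
proof -
  obtain A x y where xy: "flat (phrase p) = x @ [Some A, Some A] @ y" "flat (phrase p') = x @ y"
    "alphabet p' = alphabet p - {A}" "\<forall>L \<in> alphabet p'. proj p' L = proj p L"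
    using H1 unfolding H1_move_def by blast
  have in': "L \<in> alphabet p'" if "Some L \<in> set x \<or> Some L \<in> set y" for L
    using flat_letter(1)[OF p', of L] that xy(2) by simp
  then have notin: "Some A \<notin> set x" "Some A \<notin> set y" using xy(3) by blast+
  have agree: "agree p p' M M L" if "Some L \<in> set x \<or> Some L \<in> set y" for L
  proof (rule agreeI)
    have "A \<noteq> L" using that notin by blast
    then show "flat_comps 0 (flat (phrase p')) L = flat_comps 0 (flat (phrase p)) L"
      by (simp add: xy flat_comps_append)
  qed (use in'[OF that] xy(4) in simp_all)
  have "\<not> linking p A"
    unfolding linking_def comps_eq_flat_comps xy flat_comps_append
    using notin by (simp add: flat_comps_empty)
  then have f: "factor p M i A = 1" "ifactor p M i A = 1" for i
    by (simp_all add: factor_def ifactor_def)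
  have walk: "walk p t M (longitude p M) 0 1 1 (x @ [Some A, Some A] @ y)"
    using M walk_iff[OF p n] unfolding xy(1)[symmetric] by blast
  then have "walk p' t M (longitude p M) 0 1 1 (x @ y)"
  proof (rule walk_prefix)
    have "walk p t M (longitude p M) (0 + count_list x None) (val p M 0 1 x) (ival p M 0 1 x) y"
      using walk_suffix[OF walk] by (simp add: f)
    then show "walk p' t M (longitude p M) (0 + count_list x None) (val p M 0 1 x) (ival p M 0 1
        x) y"
      by (rule walk_agree) (use agree in blast)
  qed (use agree in simp)
  then show ?thesis
    unfolding xy(2)[symmetric] walk_iff[OF p' n] by auto
qed

text \<open>\<open>tau_v\<close> keeps over and under components and reverses the sign. Once the two
  letters are known to have the same meridian, their factors cancel at either place.\<close>

lemma H2_meridians: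
  fixes t :: "nat \<Rightarrow> 'r::ring_1"
  assumes p: "nanophrase n p" and p': "nanophrase n p'" and n: "0 < n" and H2: "H2_move p p'"
    and nil: "\<And>h x. t h * (x * t h) = 0" and M: "meridians p t M"
  shows "meridians p' t M \<and> (\<forall>i<n. t i = 0 \<longrightarrow> longitude p' M i = longitude p M i)"
proof -
  obtain A B x y z where xy:
    "flat (phrase p) = x @ [Some A, Some B] @ y @ [Some B, Some A] @ z"
    "flat (phrase p') = x @ y @ z" "tau_v (proj p A) = proj p B"
    "alphabet p' = alphabet p - {A, B}" "\<forall>L \<in> alphabet p'. proj p' L = proj p L"
    using H2 unfolding H2_move_def by (elim exE conjE) (rule that)
  let ?L = "longitude p M"
  have in': "L \<in> alphabet p'" if "Some L \<in> set x \<or> Some L \<in> set y \<or> Some L \<in> set z" for L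
    using flat_letter(1)[OF p', of L] that xy(2) by simp
  then have notin: "Some A \<notin> set x" "Some A \<notin> set y" "Some A \<notin> set z"
      "Some B \<notin> set x" "Some B \<notin> set y" "Some B \<notin> set z"
    using xy(4) by blast+
  have agree: "agree p p' M M L" if "Some L \<in> set x \<or> Some L \<in> set y \<or> Some L \<in> set z" for L
  proof (rule agreeI)
    have "A \<noteq> L" "B \<noteq> L" using that notin by blast+
    then show "flat_comps 0 (flat (phrase p')) L = flat_comps 0 (flat (phrase p)) L"
      by (simp add: xy flat_comps_append)
  qed (use in'[OF that] xy(5) in simp_all)
  define i where "i = count_list x None"
  define k where "k = i + count_list y None"
  have comps: "flat_comps 0 (flat (phrase p)) A = {i, k}" "flat_comps 0 (flat (phrase p)) B = {i,
      k}"
    unfolding xy(1) flat_comps_append using notin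
    by (auto simp: flat_comps_empty i_def k_def)
  have "i \<le> k" by (simp add: k_def)
  then have fs: "first_comp p A = i" "second_comp p A = k" "first_comp p B = i" "second_comp p B =
      k"
    unfolding comps_eq_flat_comps comps by simp_all
  have under: "under_comp p B = under_comp p A" and over: "over_comp p B = over_comp p A"
    and pos: "positive p B \<longleftrightarrow> \<not> positive p A" and lB: "linking p B \<longleftrightarrow> linking p A"
    and lA: "linking p A \<longleftrightarrow> i \<noteq> k"
    using xy(3)[symmetric] by (cases "proj p A"; simp add: under_comp_def over_comp_def
        positive_def linking_def fs)+
  have ou: "(over_comp p A = i \<and> under_comp p A = k) \<or> (over_comp p A = k \<and> under_comp p A = i)"
    by (simp add: under_comp_def over_comp_def fs)
  have walk: "walk p t M ?L 0 1 1 (x @ [Some A, Some B] @ y @ [Some B, Some A] @ z)"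
    using M walk_iff[OF p n] unfolding xy(1)[symmetric] by blast
  note W1 = walk_suffix[OF this, folded i_def, simplified, folded i_def]
  define g g' where "g = val p M 0 1 x" and "g' = ival p M 0 1 x"
  have W2: "walk p t M ?L i (g * factor p M i A * factor p M i B)
      (ifactor p M i B * (ifactor p M i A * g')) (y @ [Some B, Some A] @ z)"
    using W1 by (simp add: g_def g'_def)
  note W3 = walk_suffix[OF W2, folded k_def]
  have sq: "M A * M A = 0" if "linking p A"
    using meridian_nil[OF p nil M flat_letter(1)[OF p] that, of 1] xy(1) by simp
  \<comment> \<open>On the overcrossing strand the letters are adjacent, and passing over
    contributes the factor 1; so both see the same conjugate of the generator.\<close>
  have eq: "M B = M A" if l: "linking p A"
    using ou
  proof
    assume "over_comp p A = i \<and> under_comp p A = k"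
    then show ?thesis using l W1 lA lB over by (auto simp: factor_def ifactor_def)
  next
    assume "over_comp p A = k \<and> under_comp p A = i"
    then show ?thesis using l W3 lA lB over under by (auto simp: factor_def ifactor_def)
  qed
  have f: "factor p M m A * factor p M m B = 1" "ifactor p M m B * ifactor p M m A = 1"
    "factor p M m B * factor p M m A = 1" "ifactor p M m A * ifactor p M m B = 1" for m
    using lB under pos sq eq by (auto simp: factor_def ifactor_def algebra_simps)
  have W2': "walk p t M ?L i g g' (y @ [Some B, Some A] @ z)"
    using W2 by (simp add: mult.assoc f) (simp add: mult.assoc[symmetric] f)
  have "walk p t M ?L k (val p M i g y) (ival p M i g' y) z"
    using walk_suffix[OF W2', folded k_def]
    by (simp add: mult.assoc f) (simp add: mult.assoc[symmetric] f)
  then have "walk p' t M ?L k (val p M i g y) (ival p M i g' y) z"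
    by (rule walk_agree) (use agree in blast)
  then have "walk p' t M ?L i g g' (y @ z)"
    unfolding k_def by (intro walk_prefix[OF W2']) (use agree in blast)
  then have "walk p' t M ?L 0 1 1 (x @ y @ z)"
    by (intro walk_prefix[OF walk]) (use agree in \<open>auto simp: i_def g_def g'_def\<close>)
  then show ?thesis
    unfolding xy(2)[symmetric] walk_iff[OF p' n] by auto
qed

section \<open>The third move\<close>

definition first_under :: "alpha_v \<Rightarrow> bool" where
  "first_under c \<longleftrightarrow> c \<in> {b_plus, a_minus}"

text \<open>\<open>factor\<close> with the nanophrase abstracted away: \<open>u\<close> says that
  the strand in question passes under at a linking crossing. The third move thereby becomes a
  statement about a ring.\<close>

definition gen :: "bool \<Rightarrow> alpha_v \<Rightarrow> 'r::ring_1 \<Rightarrow> 'r" where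
  "gen u c m = (if u then (if c \<in> {a_plus, b_plus} then 1 + m else 1 - m) else 1)"

definition igen :: "bool \<Rightarrow> alpha_v \<Rightarrow> 'r::ring_1 \<Rightarrow> 'r" where
  "igen u c m = (if u then (if c \<in> {a_plus, b_plus} then 1 - m else 1 + m) else 1)"

text \<open>
  In the third move \<open>\<alpha>\<close>, \<open>\<beta>\<close>, \<open>\<gamma>\<close> are the conjugates of the generators at the three places
  where letters are swapped.  If two of the three strands lie in one component, the products of the
  two factors before and after the swap agree only up to the ideal of its generator, which is all
  that a subsequent walk detects.
\<close>

definition equiv_near :: "'r::ring_1 \<Rightarrow> 'r \<Rightarrow> 'r \<Rightarrow> 'r \<Rightarrow> 'r \<Rightarrow> bool" where
  "equiv_near \<alpha> u u' v v' \<longleftrightarrow> \<alpha> * u = \<alpha> * v \<and> u' * \<alpha> = v' * \<alpha> \<and> (\<alpha> = 0 \<longrightarrow> u = v)"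

lemma equiv_nearI: "u = v \<Longrightarrow> u' = v' \<Longrightarrow> equiv_near \<alpha> u u' v v'"
  by (simp add: equiv_near_def)

text \<open>Let strands 1, 2, 3 be the places with AB, AC, BC, in components \<open>i\<close>,
  \<open>j\<close>, \<open>k\<close>. Of the eight sign patterns with letters a, \<open>S_v\<close>
  omits just the two in which the strands lie cyclically above one another, and likewise for b; the
  rest are the usual triangle moves. Hypotheses \<open>A1\<close> to \<open>C3\<close> are the
  equations before the swap, the first six conclusions those after it.\<close>

lemma H3_algebra:
  fixes \<alpha> \<beta> \<gamma> mA mB mC :: "'r::ring_1"
  assumes S: "(a, b, c) \<in> S_v" and ijk: "i \<le> j" "j \<le> (k::nat)"
    and nil: "\<And>x. \<alpha> * (x * \<alpha>) = 0" "\<And>x. \<beta> * (x * \<beta>) = 0" "\<And>x. \<gamma> * (x * \<gamma>) = 0"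
    and ij: "\<And>x. i = j \<Longrightarrow> \<alpha> * (x * \<beta>) = 0" "\<And>x. i = j \<Longrightarrow> \<beta> * (x * \<alpha>) = 0"
    and jk: "\<And>x. j = k \<Longrightarrow> \<beta> * (x * \<gamma>) = 0" "\<And>x. j = k \<Longrightarrow> \<gamma> * (x * \<beta>) = 0"
    and zero_iff: "i = j \<Longrightarrow> \<alpha> = 0 \<longleftrightarrow> \<beta> = 0" "j = k \<Longrightarrow> \<beta> = 0 \<longleftrightarrow> \<gamma> = 0"
    and A1: "i \<noteq> j \<Longrightarrow> \<not> first_under a \<Longrightarrow> mA = \<alpha>"
    and A2: "i \<noteq> j \<Longrightarrow> first_under a \<Longrightarrow> mA = \<beta>"
    and B1: "i \<noteq> k \<Longrightarrow> \<not> first_under b \<Longrightarrow>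
      mB = igen (i \<noteq> j \<and> first_under a) a mA * \<alpha> * gen (i \<noteq> j \<and> first_under a) a mA"
    and B3: "i \<noteq> k \<Longrightarrow> first_under b \<Longrightarrow> mB = \<gamma>"
    and C2: "j \<noteq> k \<Longrightarrow> \<not> first_under c \<Longrightarrow>
      mC = igen (i \<noteq> j \<and> \<not> first_under a) a mA * \<beta> * gen (i \<noteq> j \<and> \<not> first_under a) a mA"
    and C3: "j \<noteq> k \<Longrightarrow> first_under c \<Longrightarrow>
      mC = igen (i \<noteq> k \<and> \<not> first_under b) b mB * \<gamma> * gen (i \<noteq> k \<and> \<not> first_under b) b mB"
  obtains mA' mB' mC' where
    "\<not> first_under b \<longrightarrow> mB' = \<alpha>"
    "\<not> first_under a \<longrightarrow>
      mA' = igen (i \<noteq> k \<and> first_under b) b mB' * \<alpha> * gen (i \<noteq> k \<and> first_under b) b mB'"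
    "\<not> first_under c \<longrightarrow> mC' = \<beta>"
    "first_under a \<longrightarrow>
      mA' = igen (j \<noteq> k \<and> first_under c) c mC' * \<beta> * gen (j \<noteq> k \<and> first_under c) c mC'"
    "first_under c \<longrightarrow> mC' = \<gamma>"
    "first_under b \<longrightarrow>
      mB' = igen (j \<noteq> k \<and> \<not> first_under c) c mC' * \<gamma> * gen (j \<noteq> k \<and> \<not> first_under c) c mC'"
    "equiv_near \<alpha>
      (gen (i \<noteq> j \<and> first_under a) a mA * gen (i \<noteq> k \<and> first_under b) b mB)
      (igen (i \<noteq> k \<and> first_under b) b mB * igen (i \<noteq> j \<and> first_under a) a mA)
      (gen (i \<noteq> k \<and> first_under b) b mB' * gen (i \<noteq> j \<and> first_under a) a mA')
      (igen (i \<noteq> j \<and> first_under a) a mA' * igen (i \<noteq> k \<and> first_under b) b mB')"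
    "equiv_near \<beta>
      (gen (i \<noteq> j \<and> \<not> first_under a) a mA * gen (j \<noteq> k \<and> first_under c) c mC)
      (igen (j \<noteq> k \<and> first_under c) c mC * igen (i \<noteq> j \<and> \<not> first_under a) a mA)
      (gen (j \<noteq> k \<and> first_under c) c mC' * gen (i \<noteq> j \<and> \<not> first_under a) a mA')
      (igen (i \<noteq> j \<and> \<not> first_under a) a mA' * igen (j \<noteq> k \<and> first_under c) c mC')"
    "equiv_near \<gamma>
      (gen (i \<noteq> k \<and> \<not> first_under b) b mB * gen (j \<noteq> k \<and> \<not> first_under c) c mC)
      (igen (j \<noteq> k \<and> \<not> first_under c) c mC * igen (i \<noteq> k \<and> \<not> first_under b) b mB)
      (gen (j \<noteq> k \<and> \<not> first_under c) c mC' * gen (i \<noteq> k \<and> \<not> first_under b) b mB')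
      (igen (i \<noteq> k \<and> \<not> first_under b) b mB' * igen (j \<noteq> k \<and> \<not> first_under c) c mC')"
proof -
  \<comment> \<open>After the swap C comes before A and B, and B before A; in this order each new
    meridian uses only those already defined.\<close>
  define mC' where "mC' = (if first_under c then \<gamma> else \<beta>)"
  define mB' where "mB' = (if first_under b then
      igen (j \<noteq> k \<and> \<not> first_under c) c mC' * \<gamma> * gen (j \<noteq> k \<and> \<not> first_under c) c mC' else \<alpha>)"
  define mA' where "mA' = (if first_under a then
      igen (j \<noteq> k \<and> first_under c) c mC' * \<beta> * gen (j \<noteq> k \<and> first_under c) c mC'
    else igen (i \<noteq> k \<and> first_under b) b mB' * \<alpha> * gen (i \<noteq> k \<and> first_under b) b mB')"
  have nil2: "\<alpha> * \<alpha> = 0" "\<beta> * \<beta> = 0" "\<gamma> * \<gamma> = 0"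
    using nil(1)[of 1] nil(2)[of 1] nil(3)[of 1] by simp_all
  \<comment> \<open>The nil relations for right-nested products, the form in which
    \<open>algebra_simps\<close> leaves them.\<close>
  have zero: "\<alpha> * (\<alpha> * y) = 0" "\<beta> * (\<beta> * y) = 0" "\<gamma> * (\<gamma> * y) = 0"
    "\<alpha> * (x * (\<alpha> * y)) = 0" "\<beta> * (x * (\<beta> * y)) = 0" "\<gamma> * (x * (\<gamma> * y)) = 0"
    "\<alpha> * (x * (w * (\<alpha> * y))) = 0" "\<beta> * (x * (w * (\<beta> * y))) = 0" "\<gamma> * (x * (w * (\<gamma> * y))) = 0"
    "\<alpha> * (x * (w * \<alpha>)) = 0" "\<beta> * (x * (w * \<beta>)) = 0" "\<gamma> * (x * (w * \<gamma>)) = 0" for x y w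
    using arg_cong[OF nil(1)[of 1], of "\<lambda>z. z * y"] arg_cong[OF nil(2)[of 1], of "\<lambda>z. z * y"]
      arg_cong[OF nil(3)[of 1], of "\<lambda>z. z * y"]
      arg_cong[OF nil(1)[of x], of "\<lambda>z. z * y"] arg_cong[OF nil(2)[of x], of "\<lambda>z. z * y"]
      arg_cong[OF nil(3)[of x], of "\<lambda>z. z * y"]
      arg_cong[OF nil(1)[of "x * w"], of "\<lambda>z. z * y"] arg_cong[OF nil(2)[of "x * w"], of "\<lambda>z. z *
          y"]
      arg_cong[OF nil(3)[of "x * w"], of "\<lambda>z. z * y"] nil(1)[of "x * w"] nil(2)[of "x * w"]
          nil(3)[of "x * w"]
    by (simp_all add: mult.assoc)
  note zs = nil nil2 zero
  have ij0: "\<alpha> * \<beta> = 0 \<and> \<beta> * \<alpha> = 0 \<and> (\<forall>x. \<alpha> * (\<beta> * x) = 0 \<and> \<beta> * (\<alpha> * x) = 0)" if "i = j"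
    using ij[OF that, of 1] by (simp add: mult.assoc[symmetric])
  have jk0: "\<beta> * \<gamma> = 0 \<and> \<gamma> * \<beta> = 0 \<and> (\<forall>x. \<beta> * (\<gamma> * x) = 0 \<and> \<gamma> * (\<beta> * x) = 0)" if "j = k"
    using jk[OF that, of 1] by (simp add: mult.assoc[symmetric])
  \<comment> \<open>The places stand in this order, so \<open>i = k\<close> forces all three
    components to be equal.\<close>
  consider "i \<noteq> j" "j \<noteq> k" "i \<noteq> k" | "i = j" "j \<noteq> k" | "i \<noteq> j" "j = k" | "i = j" "j = k"
    using ijk by fastforce
  then show ?thesis
  proof cases
    case 1
    show ?thesis
      apply (rule that[of mB' mA' mC'])
      using S unfolding S_v_def
      by (auto intro!: equiv_nearI simp: gen_def igen_def first_under_def mA'_def mB'_def mC'_def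
         1 A1 A2 B1 B3 C2 C3 zs algebra_simps)
  next
    case 2
    show ?thesis
      apply (rule that[of mB' mA' mC'])
      using S ij[OF 2(1)] ij0[OF 2(1)] zero_iff(1)[OF 2(1)] unfolding S_v_def
      by (auto simp: equiv_near_def gen_def igen_def first_under_def mA'_def mB'_def mC'_def
         2 A1 A2 B1 B3 C2 C3 zs algebra_simps)
  next
    case 3
    show ?thesis
      apply (rule that[of mB' mA' mC'])
      using S jk[OF 3(2)] jk0[OF 3(2)] zero_iff(2)[OF 3(2)] unfolding S_v_def
      by (auto simp: equiv_near_def gen_def igen_def first_under_def mA'_def mB'_def mC'_def
         3 A1 A2 B1 B3 C2 C3 zs algebra_simps)
  next
    case 4
    show ?thesis
      apply (rule that[of mB' mA' mC'])
      unfolding S_v_def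
      by (auto simp: equiv_near_def gen_def igen_def mA'_def mB'_def mC'_def 4)
  qed
qed

lemma factor_gen:
  "factor p M i A = gen (linking p A \<and> under_comp p A = i) (proj p A) (M A)"
  "ifactor p M i A = igen (linking p A \<and> under_comp p A = i) (proj p A) (M A)"
  by (simp_all add: factor_def ifactor_def gen_def igen_def positive_def)

text \<open>\<open>t i * g\<close> equals \<open>g\<close> times the local conjugate
  \<open>g' * t i * g\<close>, so products that agree next to the conjugate may be exchanged in the
  state of a walk.\<close>

lemma walk_swap:
  fixes g :: "'r::ring_1"
  assumes walk: "walk p t M L i (g * (f1 * f2)) (f2' * f1' * g') z" and inv: "g * g' = 1"
    and eq: "equiv_near (g' * t i * g) (f1 * f2) (f2' * f1') (e1 * e2) (e2' * e1')"
  shows "walk p t M L i (g * e1 * e2) (e2' * (e1' * g')) z"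
  using walk
proof (rule walk_change_value)
  let ?\<alpha> = "g' * t i * g"
  have l: "t i * (g * u) = g * (?\<alpha> * u)" for u
    using inv by (metis mult.assoc mult_1_left)
  have r: "u * g' * t i = u * ?\<alpha> * g'" for u
  proof -
    have "u * ?\<alpha> * g' = u * (g' * t i * (g * g'))" by (simp only: mult.assoc)
    then show ?thesis by (simp add: inv mult.assoc)
  qed
  have E: "?\<alpha> * (f1 * f2) = ?\<alpha> * (e1 * e2)" "f2' * f1' * ?\<alpha> = e2' * e1' * ?\<alpha>"
    "?\<alpha> = 0 \<Longrightarrow> f1 * f2 = e1 * e2"
    using eq unfolding equiv_near_def by blast+
  show "t i * (g * (f1 * f2)) = t i * (g * e1 * e2)"
    unfolding l E(1) by (simp only: l mult.assoc[of g])
  show "f2' * f1' * g' * t i = e2' * (e1' * g') * t i"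
    unfolding r E(2) unfolding mult.assoc[of e2' e1' g', symmetric] r ..
  show "g * (f1 * f2) = g * e1 * e2" if "t i = 0"
    using E(3) that by (simp add: mult.assoc)
qed

lemma conj_nil:
  fixes g :: "'r::ring_1"
  assumes "\<And>x. s * (x * s) = 0"
  shows "g' * s * g * (x * (h' * s * h)) = 0"
proof -
  have "g' * s * g * (x * (h' * s * h)) = g' * (s * (g * x * h' * s)) * h"
    by (simp only: mult.assoc)
  then show ?thesis by (simp only: assms) simp
qed

lemma conj_eq_0_iff:
  fixes g :: "'r::ring_1"
  assumes "g * g' = 1"
  shows "g' * s * g = 0 \<longleftrightarrow> s = 0"
proof
  assume "g' * s * g = 0"
  then have "g * (g' * s * g) * g' = 0" by simp
  moreover have "g * (g' * s * g) * g' = (g * g') * s * (g * g')" by (simp only: mult.assoc)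
  ultimately show "s = 0" by (simp add: assms)
qed simp

lemma H3_meridians:
  fixes t :: "nat \<Rightarrow> 'r::ring_1"
  assumes p: "nanophrase n p" and p': "nanophrase n p'" and n: "0 < n" and H3: "H3_move p p'"
    and nil: "\<And>h x. t h * (x * t h) = 0" and M: "meridians p t M"
  shows "\<exists>M'. meridians p' t M' \<and> (\<forall>i<n. t i = 0 \<longrightarrow> longitude p' M' i = longitude p M i)"
proof -
  obtain A B C x y z w where xy:
    "flat (phrase p) = x @ [Some A, Some B] @ y @ [Some A, Some C] @ z @ [Some B, Some C] @ w"
    "flat (phrase p') = x @ [Some B, Some A] @ y @ [Some C, Some A] @ z @ [Some C, Some B] @ w"
    "(proj p A, proj p B, proj p C) \<in> S_v"
    "alphabet p' = alphabet p" "\<forall>L \<in> alphabet p'. proj p' L = proj p L"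
    using H3 unfolding H3_move_def by (elim exE conjE) (rule that)
  let ?L = "longitude p M"
  let ?a = "proj p A" and ?b = "proj p B" and ?c = "proj p C"
  have "count_list (flat (phrase p)) (Some A) = 2" "count_list (flat (phrase p)) (Some B) = 2"
    "count_list (flat (phrase p)) (Some C) = 2"
    using flat_letter(2)[OF p, of A] flat_letter(2)[OF p, of B] flat_letter(2)[OF p, of C]
    by (simp_all add: xy(1))
  then have distinct: "A \<noteq> B" "A \<noteq> C" "B \<noteq> C"
    and notin: "Some A \<notin> set x \<union> set y \<union> set z \<union> set w" "Some B \<notin> set x \<union> set y \<union> set z \<union> set w"
      "Some C \<notin> set x \<union> set y \<union> set z \<union> set w"
    unfolding xy(1) by (auto simp: count_list_0_iff split: if_splits)
  have same_comps: "flat_comps 0 (flat (phrase p')) L = flat_comps 0 (flat (phrase p)) L" for L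
    unfolding xy(1,2) by (auto simp: flat_comps_append)
  have in': "L \<in> alphabet p'" if "Some L \<in> set (flat (phrase p))" for L
    using flat_letter(1)[OF p that] xy(4) by simp
  define i where "i = count_list x None"
  define j where "j = i + count_list y None"
  define k where "k = j + count_list z None"
  have ijk: "i \<le> j" "j \<le> k" by (simp_all add: j_def k_def)
  have comps: "flat_comps 0 (flat (phrase p)) A = {i, j}" "flat_comps 0 (flat (phrase p)) B = {i,
      k}"
    "flat_comps 0 (flat (phrase p)) C = {j, k}"
    unfolding xy(1) flat_comps_append using notin distinct
    by (auto simp: flat_comps_empty i_def j_def k_def)
  have fs: "first_comp p A = i" "second_comp p A = j" "first_comp p B = i" "second_comp p B = k"
    "first_comp p C = j" "second_comp p C = k"
    unfolding comps_eq_flat_comps comps using ijk by simp_all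
  have l: "linking p A \<longleftrightarrow> i \<noteq> j" "linking p B \<longleftrightarrow> i \<noteq> k" "linking p C \<longleftrightarrow> j \<noteq> k"
    by (simp_all add: linking_def fs)
  have u: "under_comp p A = (if first_under ?a then i else j)"
    "under_comp p B = (if first_under ?b then i else k)"
    "under_comp p C = (if first_under ?c then j else k)"
    by (simp_all add: under_comp_def fs first_under_def)
  have o: "over_comp p A = (if first_under ?a then j else i)"
    "over_comp p B = (if first_under ?b then k else i)"
    "over_comp p C = (if first_under ?c then k else j)"
    by (simp_all add: over_comp_def fs first_under_def)
  have lu: "linking p A \<and> under_comp p A = i \<longleftrightarrow> i \<noteq> j \<and> first_under ?a"
    "linking p A \<and> under_comp p A = j \<longleftrightarrow> i \<noteq> j \<and> \<not> first_under ?a"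
    "linking p B \<and> under_comp p B = i \<longleftrightarrow> i \<noteq> k \<and> first_under ?b"
    "linking p B \<and> under_comp p B = k \<longleftrightarrow> i \<noteq> k \<and> \<not> first_under ?b"
    "linking p C \<and> under_comp p C = j \<longleftrightarrow> j \<noteq> k \<and> first_under ?c"
    "linking p C \<and> under_comp p C = k \<longleftrightarrow> j \<noteq> k \<and> \<not> first_under ?c"
    by (auto simp: l u)
  note gen_p = factor_gen[of p M i A, unfolded lu] factor_gen[of p M j A, unfolded lu]
    factor_gen[of p M i B, unfolded lu] factor_gen[of p M k B, unfolded lu]
    factor_gen[of p M j C, unfolded lu] factor_gen[of p M k C, unfolded lu]
  have sq: "M L * M L = 0" if "Some L \<in> set (flat (phrase p))" "linking p L" for L
    using meridian_nil[OF p nil M flat_letter(1)[OF p that(1)] that(2), of 1] by simp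
  have W0: "walk p t M ?L 0 1 1
      (x @ [Some A, Some B] @ y @ [Some A, Some C] @ z @ [Some B, Some C] @ w)"
    using M walk_iff[OF p n] unfolding xy(1)[symmetric] by blast
  define g g' where "g = val p M 0 1 x" and "g' = ival p M 0 1 x"
  note W1 = walk_suffix[OF W0, unfolded add_0_left, folded i_def g_def g'_def]
  define fA fB fA' fB' where "fA = factor p M i A" and "fB = factor p M i B"
    and "fA' = ifactor p M i A" and "fB' = ifactor p M i B"
  have W2: "walk p t M ?L i (g * (fA * fB)) (fB' * fA' * g')
      (y @ [Some A, Some C] @ z @ [Some B, Some C] @ w)"
    using W1 by (simp add: fA_def fB_def fA'_def fB'_def mult.assoc)
  define h h' where "h = val p M i (g * (fA * fB)) y" and "h' = ival p M i (fB' * fA' * g') y"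
  note W3 = walk_suffix[OF W2, folded j_def h_def h'_def]
  define eA eC eA' eC' where "eA = factor p M j A" and "eC = factor p M j C"
    and "eA' = ifactor p M j A" and "eC' = ifactor p M j C"
  have W4: "walk p t M ?L j (h * (eA * eC)) (eC' * eA' * h') (z @ [Some B, Some C] @ w)"
    using W3 by (simp add: eA_def eC_def eA'_def eC'_def mult.assoc)
  define d d' where "d = val p M j (h * (eA * eC)) z" and "d' = ival p M j (eC' * eA' * h') z"
  note W5 = walk_suffix[OF W4, folded k_def d_def d'_def]
  define dB dC dB' dC' where "dB = factor p M k B" and "dC = factor p M k C"
    and "dB' = ifactor p M k B" and "dC' = ifactor p M k C"
  have W6: "walk p t M ?L k (d * (dB * dC)) (dC' * dB' * d') w"
    using W5 by (simp add: dB_def dC_def dB'_def dC'_def mult.assoc)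
  have sqx: "linking p L \<Longrightarrow> M L * M L = 0" if "Some L \<in> set x \<union> set y \<union> set z" for L
    using sq[of L] that by (auto simp: xy(1))
  have sqABC: "linking p A \<Longrightarrow> M A * M A = 0" "linking p B \<Longrightarrow> M B * M B = 0"
    "linking p C \<Longrightarrow> M C * M C = 0"
    using sq[of A] sq[of B] sq[of C] by (simp_all add: xy(1))
  have inv_g: "g * g' = 1"
    unfolding g_def g'_def by (rule val_inverse) (use sqx in auto)
  have "g * (fA * fB) * (fB' * fA' * g') = 1"
    unfolding fA_def fB_def fA'_def fB'_def
    by (intro mult_inverse_pair factor_inverse inv_g sqABC)
  then have inv_h: "h * h' = 1"
    unfolding h_def h'_def by (intro val_inverse) (use sqx in auto)
  have "h * (eA * eC) * (eC' * eA' * h') = 1"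
    unfolding eA_def eC_def eA'_def eC'_def
    by (intro mult_inverse_pair factor_inverse inv_h sqABC)
  then have inv_d: "d * d' = 1"
    unfolding d_def d'_def by (intro val_inverse) (use sqx in auto)
  define \<alpha> \<beta> \<gamma> where "\<alpha> = g' * t i * g" and "\<beta> = h' * t j * h" and "\<gamma> = d' * t k * d"
  obtain mA' mB' mC' where m':
    "\<not> first_under ?b \<longrightarrow> mB' = \<alpha>"
    "\<not> first_under ?a \<longrightarrow>
      mA' = igen (i \<noteq> k \<and> first_under ?b) ?b mB' * \<alpha> * gen (i \<noteq> k \<and> first_under ?b) ?b mB'"
    "\<not> first_under ?c \<longrightarrow> mC' = \<beta>"
    "first_under ?a \<longrightarrow>
      mA' = igen (j \<noteq> k \<and> first_under ?c) ?c mC' * \<beta> * gen (j \<noteq> k \<and> first_under ?c) ?c mC'"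
    "first_under ?c \<longrightarrow> mC' = \<gamma>"
    "first_under ?b \<longrightarrow>
      mB' = igen (j \<noteq> k \<and> \<not> first_under ?c) ?c mC' * \<gamma> * gen (j \<noteq> k \<and> \<not> first_under ?c) ?c mC'"
    and near: "equiv_near \<alpha> (fA * fB) (fB' * fA')
      (gen (i \<noteq> k \<and> first_under ?b) ?b mB' * gen (i \<noteq> j \<and> first_under ?a) ?a mA')
      (igen (i \<noteq> j \<and> first_under ?a) ?a mA' * igen (i \<noteq> k \<and> first_under ?b) ?b mB')"
    "equiv_near \<beta> (eA * eC) (eC' * eA')
      (gen (j \<noteq> k \<and> first_under ?c) ?c mC' * gen (i \<noteq> j \<and> \<not> first_under ?a) ?a mA')
      (igen (i \<noteq> j \<and> \<not> first_under ?a) ?a mA' * igen (j \<noteq> k \<and> first_under ?c) ?c mC')"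
    "equiv_near \<gamma> (dB * dC) (dC' * dB')
      (gen (j \<noteq> k \<and> \<not> first_under ?c) ?c mC' * gen (i \<noteq> k \<and> \<not> first_under ?b) ?b mB')
      (igen (i \<noteq> k \<and> \<not> first_under ?b) ?b mB' * igen (j \<noteq> k \<and> \<not> first_under ?c) ?c mC')"
  proof (rule H3_algebra[OF xy(3) ijk, of \<alpha> \<beta> \<gamma> "M A" "M B" "M C"])
    show "\<alpha> * (X * \<alpha>) = 0" "\<beta> * (X * \<beta>) = 0" "\<gamma> * (X * \<gamma>) = 0" for X
      unfolding \<alpha>_def \<beta>_def \<gamma>_def by (intro conj_nil nil)+
    show "\<alpha> * (X * \<beta>) = 0" "\<beta> * (X * \<alpha>) = 0" if "i = j" for X
      unfolding \<alpha>_def \<beta>_def that by (intro conj_nil nil)+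
    show "\<beta> * (X * \<gamma>) = 0" "\<gamma> * (X * \<beta>) = 0" if "j = k" for X
      unfolding \<beta>_def \<gamma>_def that by (intro conj_nil nil)+
    show "\<alpha> = 0 \<longleftrightarrow> \<beta> = 0" if "i = j"
      unfolding \<alpha>_def \<beta>_def that conj_eq_0_iff[OF inv_g] conj_eq_0_iff[OF inv_h] ..
    show "\<beta> = 0 \<longleftrightarrow> \<gamma> = 0" if "j = k"
      unfolding \<beta>_def \<gamma>_def that conj_eq_0_iff[OF inv_h] conj_eq_0_iff[OF inv_d] ..
    show "i \<noteq> j \<Longrightarrow> \<not> first_under ?a \<Longrightarrow> M A = \<alpha>"
      using W1 by (simp add: l o \<alpha>_def)
    show "i \<noteq> j \<Longrightarrow> first_under ?a \<Longrightarrow> M A = \<beta>"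
      using W3 by (simp add: l o \<beta>_def)
    show "i \<noteq> k \<Longrightarrow> first_under ?b \<Longrightarrow> M B = \<gamma>"
      using W5 by (simp add: l o \<gamma>_def)
    show "i \<noteq> k \<Longrightarrow> \<not> first_under ?b \<Longrightarrow>
        M B = igen (i \<noteq> j \<and> first_under ?a) ?a (M A) * \<alpha> * gen (i \<noteq> j \<and> first_under ?a) ?a (M A)"
      using W1 unfolding gen_p[symmetric] by (simp add: l o \<alpha>_def mult.assoc)
    show "j \<noteq> k \<Longrightarrow> \<not> first_under ?c \<Longrightarrow>
        M C = igen (i \<noteq> j \<and> \<not> first_under ?a) ?a (M A) * \<beta> * gen (i \<noteq> j \<and> \<not> first_under ?a) ?a (M
            A)"
      using W3 unfolding gen_p[symmetric] by (simp add: l o \<beta>_def mult.assoc)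
    show "j \<noteq> k \<Longrightarrow> first_under ?c \<Longrightarrow>
        M C = igen (i \<noteq> k \<and> \<not> first_under ?b) ?b (M B) * \<gamma> * gen (i \<noteq> k \<and> \<not> first_under ?b) ?b (M
            B)"
      using W5 unfolding gen_p[symmetric] by (simp add: l o \<gamma>_def mult.assoc)
  qed (rule that, unfold fA_def fB_def fA'_def fB'_def eA_def eC_def eA'_def eC'_def
      dB_def dC_def dB'_def dC'_def gen_p)
  \<comment> \<open>Only the meridians at the three crossings change; the stretches in between keep
    theirs.\<close>
  define M' where "M' = M(A := mA', B := mB', C := mC')"
  have M'ABC: "M' A = mA'" "M' B = mB'" "M' C = mC'"
    using distinct by (simp_all add: M'_def)
  have agree: "agree p p' M M' L" if "Some L \<in> set x \<union> set y \<union> set z \<union> set w" for L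
  proof (rule agreeI)
    show "M' L = M L" using that notin by (auto simp: M'_def)
    show "proj p' L = proj p L" using in'[of L] that xy(1,5) by auto
  qed (rule same_comps)
  have "agree p p' M' M' L" if "L \<in> {A, B, C}" for L
  proof (rule agreeI)
    show "proj p' L = proj p L" using in'[of L] that xy(1,5) by auto
  qed (rule same_comps, rule refl)
  then have data: "linking p' L = linking p L" "under_comp p' L = under_comp p L"
    "over_comp p' L = over_comp p L" and fac: "factor p' M' m L = factor p M' m L"
    "ifactor p' M' m L = ifactor p M' m L" if "L \<in> {A, B, C}" for L m
    using that agree_factor[of p p' M' M' L m] by (simp_all add: agree_def)
  note gen_p' = factor_gen[of p M' i A, unfolded lu] factor_gen[of p M' j A, unfolded lu]
    factor_gen[of p M' i B, unfolded lu] factor_gen[of p M' k B, unfolded lu]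
    factor_gen[of p M' j C, unfolded lu] factor_gen[of p M' k C, unfolded lu]
  \<comment> \<open>The new walk is assembled from its end. Each stretch is first entered with the
    old state behind the old pair; \<open>walk_swap\<close> then replaces this state by that behind
    the swapped pair.\<close>
  have V6: "walk p' t M' ?L k (d * (dB * dC)) (dC' * dB' * d') w"
    by (rule walk_agree[OF W6]) (use agree in blast)
  have "walk p' t M' ?L k (d * factor p M' k C * factor p M' k B)
      (ifactor p M' k B * (ifactor p M' k C * d')) w"
    by (rule walk_swap[OF V6 inv_d]) (use near(3) in \<open>simp add: gen_p' M'ABC \<gamma>_def\<close>)
  then have V5: "walk p' t M' ?L k d d' ([Some C, Some B] @ w)"
    using m' by (simp add: data fac l o gen_p' M'ABC \<gamma>_def mult.assoc)
  have V4: "walk p' t M' ?L j (h * (eA * eC)) (eC' * eA' * h') (z @ [Some C, Some B] @ w)"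
    by (rule walk_prefix[OF W4]) (use agree V5 in \<open>auto simp: k_def d_def d'_def\<close>)
  have "walk p' t M' ?L j (h * factor p M' j C * factor p M' j A)
      (ifactor p M' j A * (ifactor p M' j C * h')) (z @ [Some C, Some B] @ w)"
    by (rule walk_swap[OF V4 inv_h]) (use near(2) in \<open>simp add: gen_p' M'ABC \<beta>_def\<close>)
  then have V3: "walk p' t M' ?L j h h' ([Some C, Some A] @ z @ [Some C, Some B] @ w)"
    using m' by (simp add: data fac l o gen_p' M'ABC \<beta>_def mult.assoc)
  have V2: "walk p' t M' ?L i (g * (fA * fB)) (fB' * fA' * g')
      (y @ [Some C, Some A] @ z @ [Some C, Some B] @ w)"
    by (rule walk_prefix[OF W2]) (use agree V3 in \<open>auto simp: j_def h_def h'_def\<close>)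
  have "walk p' t M' ?L i (g * factor p M' i B * factor p M' i A)
      (ifactor p M' i A * (ifactor p M' i B * g')) (y @ [Some C, Some A] @ z @ [Some C, Some B] @
          w)"
    by (rule walk_swap[OF V2 inv_g]) (use near(1) in \<open>simp add: gen_p' M'ABC \<alpha>_def\<close>)
  then have V1: "walk p' t M' ?L i g g'
      ([Some B, Some A] @ y @ [Some C, Some A] @ z @ [Some C, Some B] @ w)"
    using m' by (simp add: data fac l o gen_p' M'ABC \<alpha>_def mult.assoc)
  have "walk p' t M' ?L 0 1 1 (flat (phrase p'))"
    unfolding xy(2) by (rule walk_prefix[OF W0]) (use agree V1 in \<open>auto simp: i_def g_def g'_def\<close>)
  then show ?thesis
    unfolding walk_iff[OF p' n] by (intro exI[of _ M']) auto
qed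

section \<open>Isomorphisms and self crossings\<close>

lemma isomorphism_meridians:
  assumes p: "nanophrase n p" and p': "nanophrase n p'" and iso: "isomorphism_move p p'"
    and M: "meridians p t M"
  shows "\<exists>M'. meridians p' t M' \<and> (\<forall>i<n. longitude p' M' i = longitude p M i)"
proof -
  obtain f where bij: "bij_betw f (alphabet p) (alphabet p')"
    and proj: "\<And>A. A \<in> alphabet p \<Longrightarrow> proj p' (f A) = proj p A"
    and ph: "phrase p' = map (map f) (phrase p)"
    using iso unfolding isomorphism_move_def by blast
  have inj: "inj_on f (alphabet p)" using bij by (simp add: bij_betw_def)
  have len: "length (phrase p) = n" "length (phrase p') = n"
    using p p' by (simp_all add: nanophrase_def)
  have sub: "set (phrase p ! k) \<subseteq> alphabet p" if "k < n" for k
    using nanophrase_in_alphabet[OF p that] by blast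
  have nth: "phrase p' ! k = map f (phrase p ! k)" if "k < n" for k
    using that len by (simp add: ph)
  define M' where "M' = (\<lambda>A. M (inv_into (alphabet p) f A))"
  have comps: "{i. i < length (phrase p') \<and> f A \<in> set (phrase p' ! i)} =
      {i. i < length (phrase p) \<and> A \<in> set (phrase p ! i)}" if "A \<in> alphabet p" for A
    using inj_on_image_mem_iff[OF inj that sub] by (auto simp: len nth)
  have data: "linking p' (f A) = linking p A" "under_comp p' (f A) = under_comp p A"
    "over_comp p' (f A) = over_comp p A" "positive p' (f A) = positive p A" "M' (f A) = M A"
    if "A \<in> alphabet p" for A
    using that inj proj[OF that]
    by (simp_all add: linking_def under_comp_def over_comp_def positive_def first_comp_def
      second_comp_def comps M'_def)
  have fac: "factor p' M' m (f A) = factor p M m A" "ifactor p' M' m (f A) = ifactor p M m A"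
    if "A \<in> alphabet p" for m A
    by (simp_all add: factor_def ifactor_def data[OF that])
  have holonomy: "holonomy p' M' m (map f w) = holonomy p M m w \<and> holonomy_inv p' M' m (map f w) =
      holonomy_inv p M m w"
    if "set w \<subseteq> alphabet p" for m w
    using that by (induction w) (simp_all add: fac)
  have "M' A' = holonomy_inv p' M' k pre' * t k * holonomy p' M' k pre'"
    if k: "k < length (phrase p')" "phrase p' ! k = pre' @ A' # post'"
      and A': "linking p' A'" "over_comp p' A' = k" for k pre' A' post'
  proof -
    have kn: "k < n" using k len by simp
    obtain pre A post where w: "phrase p ! k = pre @ A # post" "pre' = map f pre" "A' = f A"
      using k(2) unfolding nth[OF kn] by (auto simp: map_eq_append_conv)
    have A: "A \<in> alphabet p" and pre: "set pre \<subseteq> alphabet p" using sub[OF kn] w by auto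
    have "M A = holonomy_inv p M k pre * t k * holonomy p M k pre"
      using M k(1) kn w A' data[OF A] len unfolding meridians_def by auto
    then show ?thesis using holonomy[OF pre] data[OF A] w by simp
  qed
  then have "meridians p' t M'" unfolding meridians_def by blast
  moreover have "longitude p' M' i = longitude p M i" if "i < n" for i
    using holonomy[OF sub[OF that]] by (simp add: longitude_def nth[OF that])
  ultimately show ?thesis by blast
qed

lemma linking_notin_suffix:
  assumes p: "nanophrase n p" and k: "k < n" and w: "phrase p ! k = pre @ A # post"
    and A: "linking p A"
  shows "A \<notin> set post"
proof
  assume "A \<in> set post"
  then obtain ys zs where "post = ys @ A # zs" by (meson split_list)
  then have "phrase p ! k = (pre @ A # ys) @ A # zs" using w by simp
  from linking_notin_prefix[OF p k this A] show False by simp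
qed

text \<open>A letter with both occurrences in one component is not linking, and the projection of
  such a letter enters neither a factor nor an equation.\<close>

lemma self_crossing_meridians:
  assumes p: "nanophrase n p" and p': "nanophrase n p'" and self: "self_crossing_move p p'"
    and M: "meridians p t M"
  shows "meridians p' t M \<and> (\<forall>i<n. longitude p' M i = longitude p M i)"
proof -
  obtain k A where k: "k < length (phrase p)" "count_list (phrase p ! k) A = 2"
    and p'_eq: "phrase p' = phrase p" "alphabet p' = alphabet p"
      "\<And>L. L \<in> alphabet p \<Longrightarrow> proj p' L = (if L = A then sigma_v (proj p L) else proj p L)"
    using self unfolding self_crossing_move_def by blast
  have len: "length (phrase p) = n" using p by (simp add: nanophrase_def)
  have "\<not> linking p A"
  proof
    assume A: "linking p A"
    have "A \<in> set (phrase p ! k)" using k(2) count_notin[of A "phrase p ! k"] by fastforce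
    then obtain pre post where w: "phrase p ! k = pre @ A # post" by (meson split_list)
    have "k < n" using k len by simp
    from linking_notin_prefix[OF p this w A] linking_notin_suffix[OF p this w A] show False
      using k(2) w by simp
  qed
  moreover have "first_comp p' L = first_comp p L" "second_comp p' L = second_comp p L" for L
    by (simp_all add: first_comp_def second_comp_def p'_eq)
  ultimately have linking: "linking p' L = linking p L" and over: "linking p L \<Longrightarrow> over_comp p' L =
      over_comp p L"
    and fac: "factor p' M m L = factor p M m L" "ifactor p' M m L = ifactor p M m L"
    if "L \<in> alphabet p" for L m
    using p'_eq(3)[OF that]
    by (auto simp: linking_def over_comp_def under_comp_def positive_def factor_def ifactor_def)
  have holonomy: "holonomy p' M m w = holonomy p M m w \<and> holonomy_inv p' M m w = holonomy_inv p M
      m w"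
    if "set w \<subseteq> alphabet p" for m w
    using that by (induction w) (simp_all add: fac)
  have sub: "set (phrase p ! k) \<subseteq> alphabet p" if "k < n" for k
    using nanophrase_in_alphabet[OF p that] by blast
  have "M L = holonomy_inv p' M k pre * t k * holonomy p' M k pre"
    if k: "k < length (phrase p')" "phrase p' ! k = pre @ L # post"
      and L: "linking p' L" "over_comp p' L = k" for k pre L post
  proof -
    have kn: "k < n" using k len by (simp add: p'_eq)
    have al: "L \<in> alphabet p" "set pre \<subseteq> alphabet p" using sub[OF kn] k(2) p'_eq by auto
    have "M L = holonomy_inv p M k pre * t k * holonomy p M k pre"
      using M k L linking[OF al(1)] over[OF al(1)] unfolding meridians_def p'_eq by auto
    then show ?thesis using holonomy[OF al(2)] by simp
  qed
  then have "meridians p' t M" unfolding meridians_def by blast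
  moreover have "longitude p' M i = longitude p M i" if "i < n" for i
    using holonomy[OF sub[OF that]] by (simp add: longitude_def p'_eq)
  ultimately show ?thesis by blast
qed

section \<open>Shifts\<close>

text \<open>
  Moving the base point of component \<open>j\<close> past an undercrossing conjugates the meridian of its first
  arc.  Moving it past an overcrossing is harmless once the longitude commutes with that meridian.
\<close>

lemma shift_meridians:
  fixes t :: "nat \<Rightarrow> 'r::ring_1"
  assumes p: "nanophrase n p" and p': "nanophrase n p'" and j: "j < n" "phrase p ! j = A # x"
    and p'_eq: "phrase p' = (phrase p)[j := x @ [A]]" "alphabet p' = alphabet p"
      "\<forall>L\<in>alphabet p.
         proj p' L = (if L = A \<and> A \<in> set x then nu_v (proj p L) else proj p L)"
    and nil: "\<And>h x. t h * (x * t h) = 0" and M: "meridians p t M"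
    and comm: "t j * longitude p M j = longitude p M j * t j"
  defines "g \<equiv> factor p M j A" and "g' \<equiv> ifactor p M j A"
  shows "meridians p' (t(j := g' * t j * g)) M"
    and "i < n \<Longrightarrow> longitude p' M i = (if i = j then g' * longitude p M j * g else longitude p M i)"
    and "g * g' = 1"
proof -
  have len: "length (phrase p) = n" "length (phrase p') = n"
    using p p' by (simp_all add: nanophrase_def)
  have nth: "phrase p' ! k = (if k = j then x @ [A] else phrase p ! k)" if "k < n" for k
    using that j len by (simp add: p'_eq)
  have sub: "set (phrase p ! k) \<subseteq> alphabet p" if "k < n" for k
    using nanophrase_in_alphabet[OF p that] by blast
  have Ax: "A \<in> alphabet p" "set x \<subseteq> alphabet p" using sub[OF j(1)] j(2) by auto
  have "{i. i < length (phrase p') \<and> L \<in> set (phrase p' ! i)} =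
      {i. i < length (phrase p) \<and> L \<in> set (phrase p ! i)}" for L
    using j by (auto simp: len nth split: if_splits)
  then have fs: "first_comp p' L = first_comp p L" "second_comp p' L = second_comp p L" for L
    by (simp_all add: first_comp_def second_comp_def)
  \<comment> \<open>Hence \<open>nu_v\<close> is applied only to a letter that is not linking, where
    the projection has no effect.\<close>
  have "A \<notin> set x" if "linking p A"
    using linking_notin_suffix[OF p j(1) _ that, of "[]" x] j(2) by simp
  then have linking: "linking p' L = linking p L" and over: "linking p L \<Longrightarrow> over_comp p' L =
      over_comp p L"
    and fac: "factor p' M m L = factor p M m L" "ifactor p' M m L = ifactor p M m L"
    if "L \<in> alphabet p" for L m
    using p'_eq(3)[rule_format, OF that]
    by (auto simp: fs linking_def over_comp_def under_comp_def positive_def factor_def ifactor_def)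
  have holonomy: "holonomy p' M m w = holonomy p M m w" "holonomy_inv p' M m w = holonomy_inv p M
      m w"
    if "set w \<subseteq> alphabet p" for m w
    using that by (induction w) (simp_all add: fac)
  have sq: "M L * M L = 0" if "L \<in> alphabet p" "linking p L" for L
    using meridian_nil[OF p nil M that, of 1] by simp
  show gg: "g * g' = 1"
    unfolding g_def g'_def by (rule factor_inverse(1)) (use sq Ax in blast)
  have Lj: "longitude p M j = g * holonomy p M j x"
    by (simp add: longitude_def j g_def)
  have "M L = holonomy_inv p' M k pre * (t(j := g' * t j * g)) k * holonomy p' M k pre"
    if k: "k < length (phrase p')" "phrase p' ! k = pre @ L # post"
      and L: "linking p' L" "over_comp p' L = k" for k pre L post
  proof -
    have kn: "k < n" using k len by simp
    have al: "L \<in> alphabet p" "set pre \<subseteq> alphabet p"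
      using nanophrase_in_alphabet[OF p' kn] k(2) p'_eq(2) by auto
    note L' = linking[OF al(1)] over[OF al(1)]
    have Mk: "M L = holonomy_inv p M k pre0 * t k * holonomy p M k pre0"
      if "phrase p ! k = pre0 @ L # post0" for pre0 post0
      using M kn that L L' len unfolding meridians_def by auto
    show ?thesis
    proof (cases "k = j")
      case False
      then show ?thesis using Mk[of pre post] k(2) nth[OF kn] holonomy[OF al(2)] by simp
    next
      case True
      then have split: "x @ [A] = pre @ L # post" using k(2) nth[OF kn] by simp
      show ?thesis
      proof (cases post rule: rev_cases)
        \<comment> \<open>Here \<open>L\<close> is the shifted letter itself. It passes over in
          component \<open>j\<close>, so the generator is unchanged, but the letter is now read
          after the rest of the component: its meridian is conjugated by the longitude.\<close>
        case Nil
        then have pre: "pre = x" and LA: "L = A" using split by auto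
        have g1: "g = 1" "g' = 1"
        proof -
          have "under_comp p A \<noteq> j"
            using L L' True LA by (auto simp: linking_def under_comp_def over_comp_def split:
                if_splits)
          then show "g = 1" "g' = 1" by (simp_all add: g_def g'_def factor_def ifactor_def)
        qed
        have "holonomy_inv p M j x * (t j * holonomy p M j x) = (holonomy_inv p M j x * holonomy p
            M j x) * t j"
          using comm by (simp add: Lj g1 mult.assoc)
        also have "\<dots> = t j"
          by (subst holonomy_inverse(2)) (use sq Ax in auto)
        also have "t j = M L" using Mk[of "[]" x] True LA j(2) by simp
        finally show ?thesis using True g1 holonomy[OF al(2)] pre by (simp add: mult.assoc)
      next
        \<comment> \<open>The other letters lose the leading \<open>A\<close> from their prefix;
          conjugating the generator by \<open>g\<close> makes up for it.\<close>
        case (snoc post0 B)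
        then have "x = pre @ L # post0" using split by auto
        then have "M L = holonomy_inv p M j (A # pre) * t j * holonomy p M j (A # pre)"
          using Mk[of "A # pre" post0] True j(2) by simp
        then show ?thesis using True holonomy[OF al(2)] by (simp add: g_def g'_def mult.assoc)
      qed
    qed
  qed
  then show "meridians p' (t(j := g' * t j * g)) M" unfolding meridians_def by blast
  have gg': "g' * g = 1"
    unfolding g_def g'_def by (rule factor_inverse(2)) (use sq Ax in blast)
  show "longitude p' M i = (if i = j then g' * longitude p M j * g else longitude p M i)" if "i < n"
  proof (cases "i = j")
    case True
    have "g' * longitude p M j * g = (g' * g) * holonomy p M j x * g"
      by (simp only: Lj mult.assoc)
    then have "g' * longitude p M j * g = holonomy p M j x * g" by (simp add: gg')
    moreover have "longitude p' M j = holonomy p M j x * g"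
      using True that by (simp add: longitude_def nth holonomy Ax fac g_def)
    ultimately show ?thesis using True by simp
  next
    case False
    then show ?thesis using that holonomy[OF sub[OF that]] by (simp add: longitude_def nth)
  qed
qed

text \<open>Multiplying on both sides only widens the range of rows and columns, so a place
  \<open>s\<close> remains between them; the unit diagonals preserve the entries at
  \<open>(s, Suc s)\<close>.\<close>

lemma adapted_conj:
  assumes t: "adapted c D t" and c: "distinct c"
    and diag: "\<And>a. ent g' a a = 1" "\<And>a. ent g a a = 1"
  shows "adapted c D (t(j := g' * t j * g))"
proof -
  let ?s = "g' * t j * g"
  have sum: "ent ?s a b = (\<Sum>l=a..b. \<Sum>k=a..l. ent g' a k * ent (t j) k l * ent g l b)" for a b
    by (simp add: ent_times sum_distrib_right)
  have support: "\<exists>s. a \<le> s \<and> s < b \<and> s < length c \<and> c ! s = j" if nz: "ent ?s a b \<noteq> 0" for a b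
  proof -
    obtain l k where "l \<in> {a..b}" "k \<in> {a..l}" "ent g' a k * ent (t j) k l * ent g l b \<noteq> 0"
      using nz unfolding sum by (meson sum.neutral)
    moreover from this have "ent (t j) k l \<noteq> 0" by auto
    then obtain s where "k \<le> s" "s < l" "s < length c" "c ! s = j"
      using adapted_support[OF t] by blast
    ultimately show ?thesis by (intro exI[of _ s]) auto
  qed
  have one: "ent ?s s (Suc s) = idem D" if s: "s < length c" "c ! s = j" for s
  proof -
    have z: "ent (t j) s s = 0" "ent (t j) (Suc s) (Suc s) = 0"
      using adapted_fil[OF t, of j] by (simp_all add: fil_def)
    have "ent (t j) s (Suc s) = idem D" using t s unfolding adapted_def by auto
    then show ?thesis unfolding sum by (simp add: z diag)
  qed
  have "ent ?s a b * idem D = ent ?s a b" for a b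
  proof -
    have idem: "ent (t j) k l * idem D = ent (t j) k l" for k l
      using t unfolding adapted_def by blast
    have "ent g' a k * ent (t j) k l * ent g l b * idem D =
        ent g' a k * (ent (t j) k l * idem D) * ent g l b" for k l
      by (simp only: ac_simps)
    then show ?thesis unfolding sum sum_distrib_right by (simp only: idem)
  qed
  then show ?thesis
    using support one t unfolding adapted_def by auto
qed

lemma factor_diag:
  fixes t :: "nat \<Rightarrow> 'b::comm_ring_1 tri"
  assumes p: "nanophrase n p" and M: "meridians p t M" and t: "\<And>h. t h \<in> fil 1"
    and A: "A \<in> alphabet p"
  shows "ent (factor p M j A) a a = 1" "ent (ifactor p M j A) a a = 1"
proof -
  have "ent (M A) a a = 0" if "linking p A"
  proof -
    have "M A = meridian_step p t M A" using M A that meridians_iff_fixpoint[OF p] by blast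
    then have "M A \<in> fil 1"
      unfolding meridian_step_def Let_def by (metis fil_mult_left fil_mult_right t)
    then show ?thesis by (simp add: fil_def)
  qed
  then show "ent (factor p M j A) a a = 1" "ent (ifactor p M j A) a a = 1"
    by (auto simp: factor_def ifactor_def)
qed

lemma longitude_diag:
  fixes t :: "nat \<Rightarrow> 'b::comm_ring_1 tri"
  assumes p: "nanophrase n p" and M: "meridians p t M" and t: "\<And>h. t h \<in> fil 1" and i: "i < n"
  shows "ent (longitude p M i) a a = 1"
proof -
  have "ent (holonomy p M i w) a a = 1" if "set w \<subseteq> alphabet p" for w
    using that by (induction w) (simp_all add: ent_times factor_diag[OF p M t])
  then show ?thesis
    using nanophrase_in_alphabet[OF p i] unfolding longitude_def by blast
qed

text \<open>As the matrices are infinite, the commutation in \<open>shift_mu\<close> must also be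
  checked in columns beyond \<open>length c\<close>. The elementary generators have no entries
  there.\<close>

lemma longitude_beyond:
  assumes p: "nanophrase n p" and M: "meridians p (elementary c D) M" and i: "i < n"
    and c: "distinct c" "set c \<subseteq> {..<n}" and ab: "a < b" "length c < b"
  shows "ent (longitude p M i) a b = 0"
proof -
  let ?t = "elementary c D"
  have t: "adapted c D ?t" by (rule adapted_elementary)
  have sq: "?t h * ?t h = 0" for h
    using adapted_nil[OF t c(1), of h 1] by simp
  have zero: "?t h = 0" if "n \<le> h" for h
    using adapted_eq_0[OF t, of h] c that by force
  define w where "w = eta p (rho p (b + 2) (signed_word p i))"
  have expand: "ent (expand n ?t N f) a b = 0" if "a < b" for N f a
    using that
  proof (induction N arbitrary: f a)
    case (Suc N)
    have "ent (?t h) a k * ent (expand n ?t N (\<lambda>m. f (h # m))) k b = 0" for h k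
    proof (cases "ent (?t h) a k = 0")
      case False
      then have "k < b" using ab by (auto simp: ent_elementary split: if_splits)
      then show ?thesis using Suc.IH by simp
    qed simp
    then show ?case using Suc.prems by (simp add: ent_of_int ent_sum ent_times)
  qed (simp add: ent_of_int)
  have "ev ?t w - longitude p M i \<in> fil (Suc b)"
    unfolding w_def by (rule ev_rho_approximates_longitude[OF p sq adapted_fil[OF t] M i])
  moreover have "ev ?t w - expand n ?t b (phi w) \<in> fil (Suc b)"
    by (rule ev_expand[OF adapted_fil[OF t] sq zero])
  ultimately have "ent (longitude p M i) a b = ent (expand n ?t b (phi w)) a b"
    by (simp add: fil_def)
  then show ?thesis using expand[OF ab(1)] by simp
qed

section \<open>Invariance\<close>

lemma subseq_slice: "subseq (slice c a b) c"
proof -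
  have "subseq (take (b - a) (drop a c)) (drop a c)" "subseq (drop a c) c"
    by (simp_all add: prefix_imp_subseq take_is_prefix suffix_imp_subseq suffix_drop)
  then show ?thesis unfolding slice_def by (rule subseq_order.trans)
qed

lemma reduced_cyclicI:
  assumes "subseq m c" "m \<noteq> []" "m \<noteq> c"
  shows "m @ [i] \<in> reduced_cyclic (c @ [i])"
proof -
  have "length m < length c"
    using assms list_emb_length[of "(=)" m c] subseq_same_length[of m c] by fastforce
  moreover have "2 \<le> length (m @ [i])" using assms(2) by (cases m) auto
  ultimately show ?thesis
    unfolding reduced_cyclic_def using assms(1)
    by (intro CollectI conjI exI[of _ "m @ [i]"] exI[of _ 0]) simp_all
qed

text \<open>The last entry \<open>i\<close> is always eliminated here, so the slice may be all of
  \<open>c\<close>.\<close>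

lemma reduced_cyclic_slice:
  assumes "s < b" "b \<le> length c" "2 \<le> b - s"
  shows "rotate r (slice c s b) \<in> reduced_cyclic (c @ [i])"
proof -
  have "subseq (slice c s b) (c @ [i])" by (intro subseq_rev_drop_many subseq_slice)
  then show ?thesis
    unfolding reduced_cyclic_def using assms
    by (intro CollectI conjI exI[of _ "slice c s b"] exI[of _ r]) (simp_all add: length_slice)
qed

text \<open>Divisibility of the \<mu> without the last index makes longitude and generator commute;
  that of the \<mu> of proper subsequences ending in \<open>i\<close> isolates the corner
  entry.\<close>

lemma shift_mu:
  assumes p: "nanophrase n p" and p': "nanophrase n p'" and shift: "shift_move p p'"
    and c: "distinct (c @ [i])" "set (c @ [i]) \<subseteq> {..<n}" "c \<noteq> []"
    and D: "\<And>d. d \<in> reduced_cyclic (c @ [i]) \<Longrightarrow> D dvd mu p (butlast d) (last d)"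
    and D': "\<And>d. d \<in> reduced_cyclic (c @ [i]) \<Longrightarrow> D dvd mu p' (butlast d) (last d)"
  shows "[mu p c i = mu p' c i] (mod D)"
proof -
  obtain j A x where jA: "j < length (phrase p)" "phrase p ! j = A # x"
    "phrase p' = (phrase p)[j := x @ [A]]" "alphabet p' = alphabet p"
    "\<forall>L\<in>alphabet p.
       proj p' L = (if L = A \<and> A \<in> set x then nu_v (proj p L) else proj p L)"
    using shift unfolding shift_move_def by (elim exE conjE) (rule that)
  have j: "j < n" using jA(1) p by (simp add: nanophrase_def)
  have i: "i < n" and dc: "distinct c" and sc: "set c \<subseteq> {..<n}" using c by auto
  define u where "u = length c"
  have u: "0 < u" using c(3) by (simp add: u_def)
  let ?t = "elementary c D"
  have t: "adapted c D ?t" by (rule adapted_elementary)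
  obtain M where M: "meridians p ?t M"
    by (rule meridians_exist[OF p adapted_fil[OF t]])
  have entry: "ent (longitude p M k) a b = of_int (mu p (slice c a b) k) * idem D"
    if "k < n" "a < b" "b \<le> u" for k a b
    by (rule longitude_entry[OF p that(1) t dc sc M that(2) that(3)[unfolded u_def]])
      (intro disjI1 allI impI, erule elementary_superdiagonal)
  have kill: "of_int y * idem D = 0" if "D dvd y" for y
    using that by (simp only: of_int_mult_idem_eq_0)
  have comm: "?t j * longitude p M j = longitude p M j * ?t j"
  proof (cases "j \<in> set c")
    case False
    then show ?thesis by (simp add: adapted_eq_0[OF t])
  next
    case True
    then obtain s where s: "s < length c" "c ! s = j" by (auto simp: in_set_conv_nth)
    have t_ent: "ent (?t j) a b = (if a = s \<and> b = Suc s then idem D else 0)" for a b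
      using s nth_eq_iff_index_eq[OF dc, of a s] by (auto simp: ent_elementary)
    let ?L = "longitude p M j"
    have diag: "ent ?L a a = 1" for a by (rule longitude_diag[OF p M adapted_fil[OF t] j])
    \<comment> \<open>Commuting with the entry at \<open>(s, Suc s)\<close> means that row
      \<open>Suc s\<close> and column \<open>s\<close> are trivial modulo \<open>D\<close>. Row
      entries are \<mu> of the indices after \<open>j\<close> followed by \<open>j\<close>: a slice
      starting with \<open>j\<close>, rotated by one. This is where cyclic permutations enter
      \<Delta>.\<close>
    have row: "idem D * ent ?L (Suc s) b = (if b = Suc s then idem D else 0)" for b
    proof (cases b "Suc s" rule: linorder_cases)
      case greater
      have "idem D * ent ?L (Suc s) b = 0"
      proof (cases "b \<le> u")
        case True
        have "rotate 1 (slice c s b) \<in> reduced_cyclic (c @ [i])"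
          by (rule reduced_cyclic_slice) (use greater True in \<open>auto simp: u_def\<close>)
        moreover have "rotate 1 (slice c s b) = slice c (Suc s) b @ [j]"
          using greater True s by (subst slice_simps(1)) (auto simp: u_def)
        ultimately have "slice c (Suc s) b @ [j] \<in> reduced_cyclic (c @ [i])" by (simp only:)
        from D[OF this] have "D dvd mu p (slice c (Suc s) b) j" by simp
        then have "ent ?L (Suc s) b = 0"
          unfolding entry[OF j greater True] by (rule kill)
        then show ?thesis by simp
      next
        case False
        then have "ent ?L (Suc s) b = 0"
          using longitude_beyond[OF p M j dc sc greater] by (simp add: u_def)
        then show ?thesis by simp
      qed
      then show ?thesis using greater by simp
    qed (simp_all add: ent_below diag)
    have col: "ent ?L a s * idem D = (if a = s then idem D else 0)" for a
    proof (cases a s rule: linorder_cases)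
      case less
      have "rotate 0 (slice c a (Suc s)) \<in> reduced_cyclic (c @ [i])"
        by (rule reduced_cyclic_slice) (use less s in auto)
      moreover have "slice c a (Suc s) = slice c a s @ [j]"
        using less s by (simp add: slice_def Suc_diff_le take_Suc_conv_app_nth)
      ultimately have "slice c a s @ [j] \<in> reduced_cyclic (c @ [i])" by simp
      from D[OF this] have "D dvd mu p (slice c a s) j" by simp
      then show ?thesis
        using entry[OF j less] kill s less by (simp add: u_def)
    qed (simp_all add: ent_below diag)
    show ?thesis
    proof (rule tri_eqI)
      fix a b
      have "ent (?t j * ?L) a b = (\<Sum>k=a..b. if k = Suc s then (if a = s then idem D * ent ?L (Suc
          s) b else 0) else 0)"
        unfolding ent_times t_ent by (intro sum.cong) auto
      also have "\<dots> = (if a = s \<and> b = Suc s then idem D else 0)"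
        by (auto simp: row)
      also have "\<dots> = (\<Sum>k=a..b. if k = s then (if b = Suc s then ent ?L a s * idem D else 0) else 0)"
        by (auto simp: col)
      also have "\<dots> = ent (?L * ?t j) a b"
        unfolding ent_times t_ent by (intro sum.cong) auto
      finally show "ent (?t j * ?L) a b = ent (?L * ?t j) a b" .
    qed
  qed
  define g where "g = factor p M j A"
  define g' where "g' = ifactor p M j A"
  define t' where "t' = ?t(j := g' * ?t j * g)"
  note shifted = shift_meridians[OF p p' j jA(2-5) adapted_nil[OF t dc] M comm,
      folded g_def g'_def, folded t'_def]
  have A: "A \<in> alphabet p" using nanophrase_in_alphabet[OF p j] jA(2) by simp
  have g_diag: "ent g a a = 1" "ent g' a a = 1" for a
    unfolding g_def g'_def by (rule factor_diag[OF p M adapted_fil[OF t] A])+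
  have t': "adapted c D t'"
    unfolding t'_def by (rule adapted_conj[OF t dc g_diag(2,1)])
  let ?L = "longitude p M i" and ?L' = "longitude p' M i"
  have small: "D dvd mu p m i" "D dvd mu p' m i" if "subseq m c" "m \<noteq> []" "m \<noteq> c" for m
    using D[OF reduced_cyclicI[OF that]] D'[OF reduced_cyclicI[OF that]] by simp_all
  have slice_ne: "slice c a b \<noteq> []" "slice c a b \<noteq> c" if "a < b" "b \<le> u" "b - a \<noteq> u" for a b
    using that length_slice[of b c a] by (auto simp: u_def)
  \<comment> \<open>The conjugated generator may have entries above the superdiagonal, so proper
    subsequences contribute and must be removed by divisibility for \<open>p'\<close>.\<close>
  have entry': "ent ?L' a u = of_int (mu p' (slice c a u) i) * idem D" if "a < u" for a
  proof (rule longitude_entry[OF p' i t' dc sc shifted(1) that])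
    show "u \<le> length c" by (simp add: u_def)
    show "(\<forall>h a b. ent (t' h) a b \<noteq> 0 \<longrightarrow> b = Suc a) \<or>
      (\<forall>m. m \<noteq> [] \<longrightarrow> subseq m (slice c a u) \<longrightarrow> m \<noteq> slice c a u \<longrightarrow> D dvd mu p' m i)"
    proof (intro disjI2 allI impI)
      fix m assume m: "m \<noteq> []" "subseq m (slice c a u)" "m \<noteq> slice c a u"
      then have "subseq m c" using subseq_slice subseq_order.trans by blast
      moreover have "m \<noteq> c" using m subseq_slice[of c a u] subseq_order.antisym by blast
      ultimately show "D dvd mu p' m i" using small m(1) by blast
    qed
  qed
  have full: "slice c 0 u = c" by (simp add: u_def slice_full)
  have "ent ?L 0 u = ent ?L' 0 u"
  proof (cases "i = j")
    case False
    then show ?thesis using shifted(2)[OF i] by simp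
  next
    case True
    \<comment> \<open>For a shift of component \<open>i\<close> itself, the corners of
      \<open>g * ?L'\<close> and \<open>?L * g\<close> are compared. The inner entries of both
      longitudes vanish, so each corner is that of the longitude plus that of
      \<open>g\<close>.\<close>
    have "g * ?L' = (g * g') * ?L * g" using shifted(2)[OF i] True by (simp add: mult.assoc)
    then have eq: "g * ?L' = ?L * g" using shifted(3) by simp
    have diag: "ent ?L a a = 1" "ent ?L' a a = 1" for a
      using longitude_diag[OF p M adapted_fil[OF t] i] longitude_diag[OF p' shifted(1)
          adapted_fil[OF t'] i]
      by simp_all
    have split: "(\<Sum>k=0..u. f k) = f 0 + f u" if "\<And>k. 0 < k \<Longrightarrow> k < u \<Longrightarrow> f k = 0" for f :: "nat \<Rightarrow>
        residues"
    proof -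
      have "(\<Sum>k=0..u. f k) = (\<Sum>k\<in>{0, u}. f k)"
      proof (rule sum.mono_neutral_right)
        show "\<forall>k\<in>{0..u} - {0, u}. f k = 0"
        proof
          fix k assume "k \<in> {0..u} - {0, u}"
          then show "f k = 0" by (intro that) auto
        qed
      qed simp_all
      then show ?thesis using u by simp
    qed
    have "ent ?L 0 k = 0" if "0 < k" "k < u" for k
      unfolding entry[OF i that(1) less_imp_le[OF that(2)]]
      by (intro kill small(1) subseq_slice slice_ne) (use that in auto)
    then have "ent (?L * g) 0 u = ent g 0 u + ent ?L 0 u"
      unfolding ent_times by (subst split) (simp_all add: diag g_diag)
    moreover have "ent ?L' k u = 0" if "0 < k" "k < u" for k
      unfolding entry'[OF that(2)]
      by (intro kill small(2) subseq_slice slice_ne) (use that in auto)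
    then have "ent (g * ?L') 0 u = ent ?L' 0 u + ent g 0 u"
      unfolding ent_times by (subst split) (simp_all add: diag g_diag)
    ultimately show ?thesis using eq by simp
  qed
  then show ?thesis
    using entry[OF i u order_refl] entry'[OF u] unfolding full
    by (simp only: of_int_mult_idem_eq_iff)
qed

text \<open>At \<open>D\<close> = 0 a residue is an integer. As \<open>i\<close> is not in
  \<open>c\<close>, its generator is 0, which is the case in which the longitude is
  transported.\<close>

lemma mu_eq_if_longitude_eq:
  assumes p: "nanophrase n p" and p': "nanophrase n p'"
    and c: "distinct (c @ [i])" "set (c @ [i]) \<subseteq> {..<n}" "c \<noteq> []"
    and transfer: "\<And>t M. (\<And>h x. t h * (x * t h) = 0) \<Longrightarrow> meridians p t M \<Longrightarrow>
      \<exists>M'. meridians p' t M' \<and>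
        (\<forall>i<n. (t :: nat \<Rightarrow> residues tri) i = 0 \<longrightarrow> longitude p' M' i = longitude p M i)"
  shows "mu p c i = mu p' c i"
proof -
  have i: "i < n" and dc: "distinct c" and sc: "set c \<subseteq> {..<n}" using c by auto
  let ?t = "elementary c 0"
  have t: "adapted c 0 ?t" by (rule adapted_elementary)
  obtain M where M: "meridians p ?t M"
    by (rule meridians_exist[OF p adapted_fil[OF t]])
  have "?t i = 0" using adapted_eq_0[OF t] c(1) by simp
  then obtain M' where M': "meridians p' ?t M'" "longitude p' M' i = longitude p M i"
    using transfer[OF adapted_nil[OF t dc] M] i by blast
  have u: "0 < length c" using c(3) by simp
  have super: "(\<forall>h a b. ent (?t h) a b \<noteq> 0 \<longrightarrow> b = Suc a) \<or> X" for X
    by (intro disjI1 allI impI) (erule elementary_superdiagonal)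
  have "of_int (mu p c i) * idem 0 = of_int (mu p' c i) * idem 0"
    using longitude_entry[OF p i t dc sc M u order_refl super]
      longitude_entry[OF p' i t dc sc M'(1) u order_refl super]
    unfolding slice_full M'(2) by simp
  then have "[mu p c i = mu p' c i] (mod 0)" by (simp only: of_int_mult_idem_eq_iff)
  then show ?thesis by (simp only: cong_0)
qed

lemma mu_move:
  assumes move: "M_move n p p'"
    and c: "distinct (c @ [i])" "set (c @ [i]) \<subseteq> {..<n}" "c \<noteq> []"
    and D: "\<And>d. d \<in> reduced_cyclic (c @ [i]) \<Longrightarrow> D dvd mu p (butlast d) (last d)"
    and D': "\<And>d. d \<in> reduced_cyclic (c @ [i]) \<Longrightarrow> D dvd mu p' (butlast d) (last d)"
  shows "[mu p c i = mu p' c i] (mod D)"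
proof (cases "shift_move p p'")
  case True
  then show ?thesis using move shift_mu[OF _ _ True c D D'] unfolding M_move_def by blast
next
  case False
  have p: "nanophrase n p" "nanophrase n p'" using move by (simp_all add: M_move_def)
  have n: "0 < n" using c(2) by auto
  have "mu p c i = mu p' c i"
  proof (rule mu_eq_if_longitude_eq[OF p c])
    fix t :: "nat \<Rightarrow> residues tri" and M
    assume nil: "\<And>h x. t h * (x * t h) = 0" and M: "meridians p t M"
    consider "isomorphism_move p p'" | "H1_move p p'" | "H2_move p p'" | "H3_move p p'"
      | "self_crossing_move p p'"
      using move False by (auto simp: M_move_def)
    then show "\<exists>M'. meridians p' t M' \<and> (\<forall>i<n. t i = 0 \<longrightarrow> longitude p' M' i = longitude p M i)"
    proof cases
      case 1
      from isomorphism_meridians[OF p this M] show ?thesis by blast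
    next
      case 2
      from H1_meridians[OF p n this M] show ?thesis by blast
    next
      case 3
      from H2_meridians[OF p n this nil M] show ?thesis by blast
    next
      case 4
      from H3_meridians[OF p n this nil M] show ?thesis by blast
    next
      case 5
      from self_crossing_meridians[OF p this M] show ?thesis by blast
    qed
  qed
  then show ?thesis by simp
qed

text \<open>A subsequence of a rotated list splits at the rotation point; exchanging the two pieces
  gives a subsequence of the list before rotation.\<close>

lemma reduced_cyclic_trans:
  assumes d: "d \<in> reduced_cyclic e" and d': "d' \<in> reduced_cyclic d"
  shows "d' \<in> reduced_cyclic e"
proof -
  obtain f r where f: "subseq f e" "length f < length e" "d = rotate r f"
    using d unfolding reduced_cyclic_def by blast
  obtain f' r' where f': "subseq f' d" "length f' < length d" "d' = rotate r' f'" "2 \<le> length d'"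
    using d' unfolding reduced_cyclic_def by blast
  define k where "k = r mod length f"
  have "subseq f' (drop k f @ take k f)"
    using f'(1) by (simp add: f(3) rotate_drop_take k_def)
  then obtain f1 f2 where f12: "f' = f1 @ f2" "subseq f1 (drop k f)" "subseq f2 (take k f)"
    by (auto simp: subseq_append_iff)
  have "subseq (f2 @ f1) (take k f @ drop k f)"
    by (rule list_emb_append_mono[OF f12(3,2)])
  then have "subseq (f2 @ f1) f" by simp
  then have "subseq (f2 @ f1) e" using f(1) subseq_order.trans by blast
  moreover have "length (f2 @ f1) < length e"
    using f'(2) f by (simp add: f12(1))
  moreover have "d' = rotate (r' + length f2) (f2 @ f1)"
    by (simp add: f'(3) f12(1) rotate_append rotate_rotate[symmetric])
  ultimately show ?thesis unfolding reduced_cyclic_def using f'(4) by blast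
qed

text \<open>By induction, \<mu> of each shorter sequence \<open>d\<close> agrees modulo its own
  \<Delta>, which \<open>Delta p c i\<close> divides by \<open>reduced_cyclic_trans\<close>. So the
  modulus of either nanophrase divides all numbers defining that of the other, and the two
  coincide.\<close>

lemma mu_bar_move:
  assumes move: "M_move n p p'"
    and "distinct (c @ [i])" "set (c @ [i]) \<subseteq> {..<n}" "c \<noteq> []"
  shows "mu_bar p c i = mu_bar p' c i"
  using assms(2-)
proof (induction "length c" arbitrary: c i rule: less_induct)
  case less
  let ?e = "c @ [i]"
  let ?\<mu> = "\<lambda>p d. mu p (butlast d) (last d)" and ?\<Delta> = "\<lambda>p d. Delta p (butlast d) (last d)"
  have IH: "?\<Delta> p d = ?\<Delta> p' d" "[?\<mu> p d = ?\<mu> p' d] (mod ?\<Delta> p d)"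
    and d_eq: "butlast d @ [last d] = d" if d: "d \<in> reduced_cyclic ?e" for d
  proof -
    obtain f r where f: "subseq f ?e" "length f < length ?e" "d = rotate r f" "2 \<le> length d"
      using d unfolding reduced_cyclic_def by blast
    have "distinct f" "set f \<subseteq> {..<n}"
      using f(1) less.prems(1,2) set_nths_subset by (force simp: subseq_conv_nths)+
    then have d': "distinct d" "set d \<subseteq> {..<n}" by (simp_all add: f(3))
    show eq: "butlast d @ [last d] = d"
      using f(4) by (intro append_butlast_last_id) auto
    have "mu_bar p (butlast d) (last d) = mu_bar p' (butlast d) (last d)"
    proof (rule less.hyps)
      show "length (butlast d) < length c" using f by simp
      show "butlast d \<noteq> []" using f(4) by (cases d rule: rev_cases) auto
    qed (simp_all only: eq d')
    then have "?\<Delta> p d = ?\<Delta> p' d \<and>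
        {m. [m = ?\<mu> p d] (mod ?\<Delta> p d)} = {m. [m = ?\<mu> p' d] (mod ?\<Delta> p' d)}"
      unfolding mu_bar_def prod.inject .
    then have \<Delta>: "?\<Delta> p d = ?\<Delta> p' d"
      and res: "{m. [m = ?\<mu> p d] (mod ?\<Delta> p d)} = {m. [m = ?\<mu> p' d] (mod ?\<Delta> p' d)}"
      by (rule conjunct1, rule conjunct2)
    show "?\<Delta> p d = ?\<Delta> p' d" by (rule \<Delta>)
    have "?\<mu> p d \<in> {m. [m = ?\<mu> p d] (mod ?\<Delta> p d)}" by simp
    then show "[?\<mu> p d = ?\<mu> p' d] (mod ?\<Delta> p d)"
      unfolding res by (simp add: \<Delta>)
  qed
  have dvd_\<Delta>: "Delta q c i dvd ?\<Delta> q d" if d: "d \<in> reduced_cyclic ?e" for d and q :: "'a nanophrase"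
    unfolding Delta_def d_eq[OF d]
    by (rule Gcd_greatest) (auto intro!: Gcd_dvd reduced_cyclic_trans[OF d])
  have dvd: "Delta q c i dvd ?\<mu> q d" if "d \<in> reduced_cyclic ?e" for d and q :: "'a nanophrase"
    unfolding Delta_def using that by (intro Gcd_dvd) auto
  have dvd': "Delta p c i dvd ?\<mu> p' d" "Delta p' c i dvd ?\<mu> p d" if d: "d \<in> reduced_cyclic ?e" for d
  proof -
    have "[?\<mu> p d = ?\<mu> p' d] (mod Delta p c i)"
      using IH(2)[OF d] dvd_\<Delta>[OF d, of p] by (rule cong_dvd_modulus)
    then show "Delta p c i dvd ?\<mu> p' d" using dvd[OF d, of p] cong_dvd_iff by blast
    have "[?\<mu> p d = ?\<mu> p' d] (mod Delta p' c i)"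
      using IH(2)[OF d, unfolded IH(1)[OF d]] dvd_\<Delta>[OF d, of p'] by (rule cong_dvd_modulus)
    then show "Delta p' c i dvd ?\<mu> p d" using dvd[OF d, of p'] cong_dvd_iff by blast
  qed
  have "Delta p c i dvd Delta p' c i"
    unfolding Delta_def[of p'] by (rule Gcd_greatest) (use dvd'(1) in blast)
  moreover have "Delta p' c i dvd Delta p c i"
    unfolding Delta_def[of p] by (rule Gcd_greatest) (use dvd'(2) in blast)
  moreover have "0 \<le> Delta q c i" for q :: "'a nanophrase"
    by (simp add: Delta_def)
  ultimately have \<Delta>: "Delta p c i = Delta p' c i" by (intro zdvd_antisym_nonneg)
  have "[mu p c i = mu p' c i] (mod Delta p c i)"
    by (rule mu_move[OF move less.prems]) (rule dvd, assumption, rule dvd'(1))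
  then show ?case
    unfolding mu_bar_def \<Delta> by (auto intro: cong_trans cong_sym)
qed

theorem theorem3p5:
  fixes p p' :: "'a nanophrase" and n i :: nat and c :: "nat list"
  assumes "nanophrase n p" and "nanophrase n p'"
    and "M_homotopic n p p'"
    and "c \<noteq> []"
    and "distinct (c @ [i])"
    and "set (c @ [i]) \<subseteq> {..<n}"
  shows "mu_bar p c i = mu_bar p' c i"
  using assms(3) unfolding M_homotopic_def
proof (induction rule: equivclp_induct)
  case base
  show ?case ..
next
  case (step q r)
  have "mu_bar q c i = mu_bar r c i"
    using step.hyps(2)
  proof
    assume "M_move n q r"
    then show ?thesis by (rule mu_bar_move[OF _ assms(5,6,4)])
  next
    assume "M_move n r q"
    then show ?thesis by (rule mu_bar_move[OF _ assms(5,6,4), symmetric])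
  qed
  with step.IH show ?case by (rule trans)
qed

end
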